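(* For every real $\alpha>-1$, the asymptotic Markov constant $c(\alpha)=\lim_{n\to\infty}n^{-1}c_n(\alpha)$ satisfies $$\underline{c}(\alpha)<c(\alpha)<\overline{c}(\alpha),$$ where $\underline{c}(\alpha),\overline{c}(\alpha)$ are the positive numbers whose squares are $$\underline{c}^2(\alpha):=\frac{21\alpha^3+299\alpha^2+1391\alpha+2073}{(\alpha+1)(\alpha+3)(\alpha+5)(\alpha+11)(7\alpha+31)}$$ and $$\overline{c}^{\,2}(\alpha):=\begin{cases}\dfrac{\big(21\alpha^3+299\alpha^2+1391\alpha+2073\big)^{1/6}}{(\alpha+1)(\alpha+3)^{1/2}(\alpha+5)^{1/3}\big[(\alpha+7)(\alpha+9)(\alpha+11)\big]^{1/6}}, & -1<\alpha\le\alpha^{\star},\\[3mm] \dfrac{4}{\alpha^2+10\alpha+8}, & \alpha>\alpha^{\star},\end{cases}$$ with $\alpha^{\star}\approx172$ being the value of $\alpha>2$ at which the two expressions in the definition of $\overline{c}^{\,2}(\alpha)$ coincide.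
   Context: $\mathcal P_n$ denotes the set of algebraic polynomials of degree at most $n$ with real coefficients. For $\alpha>-1$, $w_\alpha(x):=x^{\alpha}e^{-x}$ is the Laguerre weight on $(0,\infty)$ and $\|f\|_{w_\alpha}:=\big(\int_0^\infty |f(x)|^2w_\alpha(x)\,dx\big)^{1/2}$. The best Markov constant is $c_n(\alpha):=\sup_{p\in\mathcal P_n,\ p\ne0}\dfrac{\|p'\|_{w_\alpha}}{\|p\|_{w_\alpha}}$, and the asymptotic Markov constant is $c(\alpha):=\lim_{n\to\infty}c_n(\alpha)/n$. It is a known result of D\"orfler that this limit exists and equals $1/j_{(\alpha-1)/2,1}$, where $j_{\nu,1}$ is the first positive zero of the Bessel function $J_\nu$. *)

theory Defs
  imports "HOL-Analysis.Analysis" "HOL-Computational_Algebra.Polynomial"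
begin

definition laguerre_weight :: "real \<Rightarrow> real \<Rightarrow> real" where
  "laguerre_weight \<alpha> x = x powr \<alpha> * exp (- x)"

definition laguerre_norm :: "real \<Rightarrow> (real \<Rightarrow> real) \<Rightarrow> real" where
  "laguerre_norm \<alpha> f = sqrt (LINT x:{0<..}|lborel. \<bar>f x\<bar>\<^sup>2 * laguerre_weight \<alpha> x)"

(* The real-valued supremum is meaningful for \<alpha> > -1: differentiation is a linear map on the
   finite-dimensional space of polynomials of degree at most n, so the quotients are bounded. *)
definition markov_constant :: "real \<Rightarrow> nat \<Rightarrow> real" where
  "markov_constant \<alpha> n =
     (SUP p \<in> {p :: real poly. degree p \<le> n \<and> p \<noteq> 0}.
        laguerre_norm \<alpha> (poly (pderiv p)) / laguerre_norm \<alpha> (poly p))"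

definition asymptotic_markov_constant :: "real \<Rightarrow> real" where
  "asymptotic_markov_constant \<alpha> = lim (\<lambda>n. markov_constant \<alpha> n / real n)"

definition c_lower :: "real \<Rightarrow> real" where
  "c_lower \<alpha> = sqrt
     ((21 * \<alpha>^3 + 299 * \<alpha>^2 + 1391 * \<alpha> + 2073) /
      ((\<alpha> + 1) * (\<alpha> + 3) * (\<alpha> + 5) * (\<alpha> + 11) * (7 * \<alpha> + 31)))"

definition c_upper_sq_1 :: "real \<Rightarrow> real" where
  "c_upper_sq_1 \<alpha> =
     (21 * \<alpha>^3 + 299 * \<alpha>^2 + 1391 * \<alpha> + 2073) powr (1/6) /
     ((\<alpha> + 1) * (\<alpha> + 3) powr (1/2) * (\<alpha> + 5) powr (1/3) *
      ((\<alpha> + 7) * (\<alpha> + 9) * (\<alpha> + 11)) powr (1/6))"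

definition c_upper_sq_2 :: "real \<Rightarrow> real" where
  "c_upper_sq_2 \<alpha> = 4 / (\<alpha>^2 + 10 * \<alpha> + 8)"

definition alpha_star :: real where
  "alpha_star = (THE a. a > 2 \<and> c_upper_sq_1 a = c_upper_sq_2 a)"

definition c_upper :: "real \<Rightarrow> real" where
  "c_upper \<alpha> = sqrt (if \<alpha> \<le> alpha_star then c_upper_sq_1 \<alpha> else c_upper_sq_2 \<alpha>)"

end

theory Submission
  imports Defs "HOL-Computational_Algebra.Fundamental_Theorem_Algebra"
    "HOL-Computational_Algebra.Polynomial_FPS"
begin

text \<open>
  In the basis of Laguerre polynomials \<open>L\<^sub>k\<close> one has \<open>L\<^sub>k' = - (L\<^sub>0 + \<dots> + L\<^sub>k\<^sub>-\<^sub>1)\<close>, so the Markov constant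
  is the best constant of a weighted discrete Hardy inequality: its inverse square is the least
  root of the polynomial \<open>u\<^sub>n\<close> generated by the associated Sturm--Liouville recurrence. All
  roots of \<open>u\<^sub>n\<close> are real and positive, and after scaling by \<open>n\<^sup>2\<close> the coefficients of \<open>u\<^sub>n\<close>
  converge to those of the entire function \<open>\<phi>\<close> with \<open>\<phi>(x\<^sup>2) = const * x powr (-\<nu>) * J\<^sub>\<nu>(x)\<close>,
  \<open>\<nu> = (\<alpha> - 1) / 2\<close>. Newton's identities then give the limits \<open>s\<^sub>k\<close> of the power sums of the
  scaled inverse roots (Rayleigh's sums over the zeros of \<open>J\<^sub>\<nu>\<close>).

  If \<open>\<Lambda>\<close> is the largest of finitely many nonnegative numbers with power sums \<open>p\<^sub>k\<close>, then
  \<open>p\<^sub>k\<^sub>+\<^sub>1 / p\<^sub>k \<le> \<Lambda> \<le> p\<^sub>k powr (1/k)\<close>; letting \<open>n \<rightarrow> \<infinity>\<close> and then \<open>k \<rightarrow> \<infinity>\<close> shows that \<open>c\<^sub>n\<^sup>2 / n\<^sup>2\<close>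
  converges to some \<open>R\<close>, and \<open>k = 5, 6\<close> give \<open>s\<^sub>6 / s\<^sub>5 \<le> R \<le> s\<^sub>6 powr (1/6)\<close>. Equality would
  propagate down to small \<open>k\<close> by log-convexity and contradict the explicit \<open>s\<^sub>2, s\<^sub>3, s\<^sub>4\<close>. For large
  \<open>\<alpha>\<close> the bound on \<open>R\<close> follows from \<open>\<phi>(1/R) = 0\<close> by a Sturm comparison of \<open>\<phi>(z x\<^sup>2)\<close> with
  \<open>x powr (-\<nu>) - 1\<close>.
\<close>

subsection \<open>Real-rooted polynomials, power sums and elementary inequalities\<close>

lemma sum_by_parts:
  fixes f g :: "nat \<Rightarrow> 'a::comm_ring_1"
  shows "(\<Sum>k<n. (\<Sum>i\<le>k. g i) * (f k - f (Suc k))) = (\<Sum>k<n. g k * f k) - (\<Sum>k<n. g k) * f n"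
  by (induction n) (simp_all add: algebra_simps lessThan_Suc_atMost[symmetric])

lemma poly_map_of_real: "poly (map_poly of_real p) (of_real x :: complex) = of_real (poly p x)"
  by (induction p) (simp_all add: map_poly_pCons)

lemma map_of_real_mult:
  "map_poly of_real (p * q) = (map_poly of_real p * map_poly of_real q :: complex poly)"
  by (rule poly_eqI) (simp add: coeff_map_poly coeff_mult)

text \<open>Since p(0) = 1, no root is 0, and a root x contributes the factor 1 - t/x; the multiset
  therefore holds inverse roots with multiplicity. Induction on the degree splits off one complex
  root, real by assumption, and rescales the cofactor so that its constant term is again 1.\<close>

lemma real_rooted_factorization:
  fixes p :: "real poly"
  assumes "poly p 0 = 1"
    and "\<And>z::complex. poly (map_poly of_real p) z = 0 \<Longrightarrow> z \<in> \<real>"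
  shows "\<exists>L. p = (\<Prod>x\<in>#L. [:1, -x:]) \<and> 0 \<notin># L"
  using assms
proof (induction "degree p" arbitrary: p)
  case 0
  then obtain c where "p = [:c:]" by (metis degree_eq_zeroE)
  with 0 have "p = (\<Prod>x\<in>#{#}. [:1, -x:])" by (simp add: one_pCons)
  then show ?case by (intro exI[of _ "{#}"]) simp
next
  case (Suc d)
  have "degree (map_poly complex_of_real p) = Suc d"
    using Suc.hyps(2) by (simp add: degree_map_poly)
  then have "\<not> constant (poly (map_poly complex_of_real p))"
    by (simp add: constant_degree)
  then obtain z where z: "poly (map_poly complex_of_real p) z = 0"
    using fundamental_theorem_of_algebra by blast
  with Suc.prems(2) obtain x where x: "z = of_real x" by (auto elim: Reals_cases)
  have "complex_of_real (poly p x) = 0" using z x by (simp add: poly_map_of_real)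
  then have px: "poly p x = 0" by simp
  then obtain q where q: "p = [:-x, 1:] * q" by (auto simp: poly_eq_0_iff_dvd)
  have x0: "x \<noteq> 0" using px Suc.prems(1) by auto
  define r where "r = smult (-x) q"
  have pr: "p = [:1, -(1/x):] * r"
    using x0 by (simp add: q r_def smult_add_right)
  have "r \<noteq> 0" using pr Suc.hyps(2) by auto
  then have deg: "d = degree r" using Suc.hyps(2) x0
    by (simp add: pr degree_mult_eq del: mult_pCons_left)
  have r1: "poly r 0 = 1" using Suc.prems(1) by (simp add: pr)
  have "\<exists>L. r = (\<Prod>x\<in>#L. [:1, -x:]) \<and> 0 \<notin># L"
  proof (rule Suc.hyps(1)[OF deg r1])
    fix z :: complex assume "poly (map_poly of_real r) z = 0"
    then have "poly (map_poly of_real p) z = 0" by (simp add: pr map_of_real_mult del: mult_pCons_left)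
    then show "z \<in> \<real>" by (rule Suc.prems(2))
  qed
  then obtain L where L: "r = (\<Prod>x\<in>#L. [:1, -x:])" "0 \<notin># L" by blast
  show ?case using L x0 by (intro exI[of _ "add_mset (1/x) L"]) (simp add: pr del: mult_pCons_left)
qed

lemma pderiv_sum: "pderiv (\<Sum>i\<in>S. f i) = (\<Sum>i\<in>S. pderiv (f i))"
  using higher_pderiv_sum[of 1 f S] by simp

lemma smult_sum_right: "smult b (\<Sum>i\<in>S. f i) = (\<Sum>i\<in>S. smult b (f i))"
  by (induction S rule: infinite_finite_induct) (simp_all add: smult_add_right)

text \<open>Logarithmic derivative of the product: as formal power series P' = -G P, where G
  generates the power sums; the identity compares coefficients at index \<open>m\<close>.\<close>

lemma newton_identities:
  fixes L :: "real multiset"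
  assumes p: "p = (\<Prod>x\<in>#L. [:1, -x:])"
  shows "real (Suc m) * coeff p (Suc m) = - (\<Sum>i\<le>m. (\<Sum>x\<in>#L. x ^ Suc i) * coeff p (m - i))"
proof -
  define G where "G L = Abs_fps (\<lambda>k. \<Sum>x\<in>#L. x ^ Suc k)" for L :: "real multiset"
  define P where "P L = (\<Prod>x\<in>#L. fps_of_poly [:1, -x:])" for L :: "real multiset"
  have "fps_deriv (P L) = - (G L * P L)" for L
  proof (induction L)
    case empty
    have "G {#} = 0" by (rule fps_ext) (simp add: G_def)
    then show ?case by (simp add: P_def)
  next
    case (add x L)
    \<comment> \<open>The series x / (1 - x t), contributed to G by the single factor 1 - x
      t.\<close>
    define g where "g = Abs_fps (\<lambda>k. x ^ Suc k)"
    have q: "fps_of_poly [:1, -x:] = 1 - fps_const x * fps_X"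
      by (simp add: fps_of_poly_pCons)
    have g: "fps_of_poly [:1, -x:] * g = fps_const x"
      unfolding q by (rule fps_ext) (auto simp: g_def left_diff_distrib mult.assoc fps_X_mult_nth gr0_conv_Suc split: nat.splits)
    have G: "G (add_mset x L) = g + G L"
      by (rule fps_ext) (simp add: G_def g_def)
    have "fps_deriv (P (add_mset x L)) = - fps_const x * P L - fps_of_poly [:1, -x:] * (G L * P L)"
      by (simp add: P_def add q) (simp add: P_def[symmetric] add q algebra_simps)
    also have "\<dots> = - (G (add_mset x L) * P (add_mset x L))"
      unfolding G g[symmetric] by (simp add: P_def algebra_simps)
    finally show ?case .
  qed
  then have "fps_nth (fps_deriv (P L)) m = - (\<Sum>i=0..m. fps_nth (G L) i * fps_nth (P L) (m - i))"
    by (simp add: fps_mult_nth)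
  moreover have "P L = fps_of_poly p"
    unfolding P_def p by (induction L) (simp_all add: fps_of_poly_mult)
  ultimately show ?thesis by (simp add: G_def atMost_atLeast0)
qed

lemma sum_mset_nonneg':
  fixes f :: "'a \<Rightarrow> real"
  shows "(\<And>x. x \<in># L \<Longrightarrow> 0 \<le> f x) \<Longrightarrow> 0 \<le> (\<Sum>x\<in>#L. f x)"
  by (induction L) auto

text \<open>Cauchy-Schwarz for weighted moments. The weights used later are 1 and the distance to
  the largest element.\<close>

lemma sum_mset_log_convex:
  fixes w :: "real \<Rightarrow> real"
  assumes "\<And>x. x \<in># L \<Longrightarrow> 0 \<le> x \<and> 0 \<le> w x"
  shows "(\<Sum>x\<in>#L. w x * x ^ Suc k)\<^sup>2 \<le> (\<Sum>x\<in>#L. w x * x ^ k) * (\<Sum>x\<in>#L. w x * x ^ Suc (Suc k))"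
  using assms
proof (induction L)
  case empty
  then show ?case by simp
next
  case (add x L)
  define a b c where "a = (\<Sum>x\<in>#L. w x * x ^ Suc k)" and "b = (\<Sum>x\<in>#L. w x * x ^ k)"
    and "c = (\<Sum>x\<in>#L. w x * x ^ Suc (Suc k))"
  have abc: "a\<^sup>2 \<le> b * c" using add by (simp add: a_def b_def c_def)
  have nn: "b \<ge> 0" "c \<ge> 0" unfolding b_def c_def
    using add.prems by (auto intro!: sum_mset_nonneg')
  have x: "x \<ge> 0" "w x \<ge> 0" using add.prems by auto
  \<comment> \<open>The cross term of the induction step: a^2 \<le> b c and the inequality of
    arithmetic and geometric means give 2 a x \<le> b x^2 + c.\<close>
  have "(2 * a * x)\<^sup>2 \<le> 4 * (b * c) * x\<^sup>2"
    using mult_right_mono[OF abc, of "4 * x\<^sup>2"] by (simp add: power_mult_distrib algebra_simps)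
  also have "\<dots> \<le> (b * x\<^sup>2 + c)\<^sup>2"
    using zero_le_power2[of "b * x\<^sup>2 - c"] by (simp add: power2_eq_square algebra_simps)
  finally have "2 * a * x \<le> b * x\<^sup>2 + c"
    by (rule power2_le_imp_le) (use nn in auto)
  then have "(w x * x ^ k) * (2 * a * x) \<le> (w x * x ^ k) * (b * x\<^sup>2 + c)"
    using x by (intro mult_left_mono) auto
  with abc have "(w x * x ^ Suc k + a)\<^sup>2 \<le> (w x * x ^ k + b) * (w x * x ^ Suc (Suc k) + c)"
    by (simp add: power2_eq_square algebra_simps)
  then show ?case by (simp add: a_def b_def c_def)
qed

section \<open>Asymptotics of binomial coefficients\<close>

lemma Suc_times_binomial_real:
  "real (Suc p) * real (n choose Suc p) = (real n - real p) * real (n choose p)"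
  using arg_cong[OF Suc_times_binomial[of p n], of real] by (simp add: algebra_simps)

lemma binomial_over_power_tendsto:
  "(\<lambda>n. real (n choose p) / real n ^ p) \<longlonglongrightarrow> 1 / fact p"
proof (induction p)
  case 0
  then show ?case by simp
next
  case (Suc p)
  have "(\<lambda>n. (1 - real p / real n) * (real (n choose p) / real n ^ p) / real (Suc p)) \<longlonglongrightarrow>
      (1 - 0) * (1 / fact p) / real (Suc p)"
    by (intro tendsto_intros Suc lim_const_over_n) auto
  moreover have "eventually (\<lambda>n. (1 - real p / real n) * (real (n choose p) / real n ^ p) / real (Suc p) =
      real (n choose Suc p) / real n ^ Suc p) sequentially"
    using eventually_gt_at_top[of 0]
  proof eventually_elim
    case (elim n)
    have "real (n choose Suc p) = (real n - real p) * real (n choose p) / real (Suc p)"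
      using Suc_times_binomial_real[of p n] by (simp add: divide_simps mult.commute)
    then show ?case using elim by (simp add: divide_simps)
  qed
  ultimately have "(\<lambda>n. real (n choose Suc p) / real n ^ Suc p) \<longlonglongrightarrow> (1 - 0) * (1 / fact p) / real (Suc p)"
    by (rule Lim_transform_eventually)
  then show ?case by (simp add: mult.commute)
qed

lemma binomial_over_higher_power_tendsto:
  assumes "p \<le> d"
  shows "(\<lambda>n. real (n choose p) / real n ^ d) \<longlonglongrightarrow> (if p = d then 1 / fact d else 0)"
proof (cases "p = d")
  case True
  then show ?thesis using binomial_over_power_tendsto[of d] by simp
next
  case False
  with assms have d: "d = p + (d - p)" "d - p > 0" by auto
  have "(\<lambda>n. real (n choose p) / real n ^ p * (1 / real n) ^ (d - p)) \<longlonglongrightarrow> 1 / fact p * 0 ^ (d - p)"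
    by (intro tendsto_intros binomial_over_power_tendsto lim_const_over_n)
  moreover have "real (n choose p) / real n ^ p * (1 / real n) ^ (d - p) = real (n choose p) / real n ^ d" for n
    by (subst (2) d(1)) (simp add: power_add power_divide)
  ultimately show ?thesis using False d(2) by (simp only: zero_power mult_zero_right if_False)
qed

text \<open>A convex power lies above its tangent at x. In \<open>A_le\<close> this plays the part
  of comparing a sum with an integral.\<close>

lemma power_tangent:
  fixes x y :: real
  assumes "0 \<le> x" "x \<le> y"
  shows "x ^ Suc m + real (Suc m) * x ^ m * (y - x) \<le> y ^ Suc m"
proof (induction m)
  case (Suc m)
  have "x ^ Suc (Suc m) + real (Suc (Suc m)) * x ^ Suc m * (y - x)
      = x * (x ^ Suc m + real (Suc m) * x ^ m * (y - x)) + x ^ Suc m * (y - x)"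
    by (simp add: algebra_simps)
  also have "\<dots> \<le> y * (x ^ Suc m + real (Suc m) * x ^ m * (y - x))"
  proof -
    have "(y - x) * x ^ Suc m \<le> (y - x) * (x ^ Suc m + real (Suc m) * x ^ m * (y - x))"
      using assms by (intro mult_left_mono) auto
    then show ?thesis by (simp add: algebra_simps)
  qed
  also have "\<dots> \<le> y * y ^ Suc m" using assms Suc by (intro mult_left_mono) auto
  finally show ?case by simp
qed simp

text \<open>Discrete Picone inequality: for v > 0 the difference of the two sides is a perfect
  square over u v. The case v = b = 0 is the last index in \<open>hardy\<close>, where b^2 / v is 0
  by the convention for division by zero.\<close>

lemma picone:
  fixes a b u v :: real
  assumes "u > 0" "v > 0 \<or> v = 0 \<and> b = 0"
  shows "(u - v) * (a\<^sup>2 / u - b\<^sup>2 / v) \<le> (a - b)\<^sup>2"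
proof (cases "v = 0")
  case True
  with assms show ?thesis by simp
next
  case False
  with assms have v: "v > 0" by auto
  have "(a - b)\<^sup>2 - (u - v) * (a\<^sup>2 / u - b\<^sup>2 / v) = (a * v - b * u)\<^sup>2 / (u * v)"
    using assms(1) v by (simp add: field_simps power2_eq_square)
  also have "\<dots> \<ge> 0" using assms(1) v by simp
  finally show ?thesis by simp
qed

lemma LIMSEQ_le_if_pos_index:
  assumes "\<And>n. n > (0::nat) \<Longrightarrow> f n \<le> (g n :: real)" "f \<longlonglongrightarrow> a" "g \<longlonglongrightarrow> b"
  shows "a \<le> b"
  by (rule tendsto_le[OF sequentially_bot assms(3,2)])
     (use assms(1) in \<open>auto intro!: eventually_mono[OF eventually_gt_at_top[of "0::nat"]]\<close>)

text \<open>A zero at one index forces the square of the preceding value to be at most 0. The bound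
  j > 1 keeps every index at which log-convexity is invoked positive.\<close>

lemma log_convex_zero_down:
  fixes f :: "nat \<Rightarrow> real"
  assumes "\<And>k. k > 0 \<Longrightarrow> (f (Suc k))\<^sup>2 \<le> f k * f (Suc (Suc k))" "f (j + k) = 0" "j > 1"
  shows "f j = 0"
  using assms(2)
proof (induction k)
  case (Suc k)
  have "(f (j + k))\<^sup>2 \<le> f (j + k - 1) * f (j + Suc k)"
    using assms(1)[of "j + k - 1"] assms(3) by simp
  with Suc show ?case by simp
qed simp

text \<open>Read \<open>X n\<close> as the largest of finitely many nonnegative numbers with power
  sums \<open>P n k\<close>. The ratios of consecutive \<open>s k\<close> increase to a limit r;
  they bound \<open>X n\<close> from below asymptotically, and the growth of \<open>s k\<close>
  bounds it from above.\<close>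

lemma max_tendsto_of_moments:
  fixes X :: "nat \<Rightarrow> real" and P :: "nat \<Rightarrow> nat \<Rightarrow> real" and s :: "nat \<Rightarrow> real"
  assumes lim: "\<And>k. k > 0 \<Longrightarrow> (\<lambda>n. P n k) \<longlonglongrightarrow> s k"
    and X: "\<And>n. n > 0 \<Longrightarrow> X n \<ge> 0"
    and lower: "\<And>n k. n > 0 \<Longrightarrow> X n ^ k \<le> P n k"
    and upper: "\<And>n k. n > 0 \<Longrightarrow> P n (Suc k) \<le> X n * P n k"
    and convex: "\<And>k. k > 0 \<Longrightarrow> (s (Suc k))\<^sup>2 \<le> s k * s (Suc (Suc k))"
    and pos: "\<And>k. k > 0 \<Longrightarrow> s k > 0"
  shows "\<exists>r>0. X \<longlonglongrightarrow> r"
proof -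
  define q where "q k = s (Suc (Suc k)) / s (Suc k)" for k
  have ev: "eventually (\<lambda>n. n > (0::nat)) sequentially" by (rule eventually_gt_at_top)
  have q_pos: "q k > 0" for k by (simp add: q_def pos)
  have inc: "incseq q"
  proof (rule incseq_SucI)
    fix k
    show "q k \<le> q (Suc k)"
      using convex[of "Suc k"] pos[of "Suc k"] pos[of "Suc (Suc k)"]
      by (simp add: q_def field_simps power2_eq_square)
  qed
  \<comment> \<open>\<open>X n\<close> is at most the first power sum, which converges; hence the
    ratios are bounded.\<close>
  have "q k \<le> s 1" for k
  proof -
    have "eventually (\<lambda>n. P n (Suc (Suc k)) \<le> P n 1 * P n (Suc k)) sequentially"
      using ev
    proof eventually_elim
      case (elim n)
      have "P n (Suc k) \<ge> 0" using lower[OF elim, of "Suc k"] X[OF elim]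
        by (meson order_trans zero_le_power)
      then show ?case using upper[OF elim, of "Suc k"] lower[OF elim, of 1]
        by (simp add: mult_right_mono order.trans)
    qed
    then have "s (Suc (Suc k)) \<le> s 1 * s (Suc k)"
      by (rule tendsto_le[OF sequentially_bot tendsto_mult[OF lim[of 1] lim[of "Suc k"]] lim[of "Suc (Suc k)"], rotated 3]) auto
    then show ?thesis using pos[of "Suc k"] by (simp add: q_def field_simps)
  qed
  with inc obtain r where r: "q \<longlonglongrightarrow> r" "\<And>k. q k \<le> r"
    using incseq_convergent[of q] by blast
  have r0: "r > 0" using q_pos[of 0] r(2)[of 0] by linarith
  have s_le: "s (Suc k) \<le> s 1 * r ^ k" for k
  proof (induction k)
    case (Suc k)
    have "s (Suc (Suc k)) \<le> r * s (Suc k)"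
      using r(2)[of k] pos[of "Suc k"] by (simp add: q_def field_simps)
    also have "\<dots> \<le> r * (s 1 * r ^ k)" using Suc r0 by (intro mult_left_mono) auto
    finally show ?case by (simp add: mult_ac)
  qed simp
  have "X \<longlonglongrightarrow> r"
  proof (rule order_tendstoI)
    fix a assume "a < r"
    with r(1) have "eventually (\<lambda>k. a < q k) sequentially" by (rule order_tendstoD)
    then obtain k where k: "a < q k" by (auto simp: eventually_sequentially)
    have "(\<lambda>n. P n (Suc (Suc k)) / P n (Suc k)) \<longlonglongrightarrow> q k"
      unfolding q_def using pos[of "Suc k"] by (intro tendsto_divide lim) auto
    then have "eventually (\<lambda>n. a < P n (Suc (Suc k)) / P n (Suc k)) sequentially"
      using k by (rule order_tendstoD)
    moreover have "eventually (\<lambda>n. 0 < P n (Suc k)) sequentially"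
      using lim[of "Suc k"] pos[of "Suc k"] by (intro order_tendstoD(1)) auto
    ultimately show "eventually (\<lambda>n. a < X n) sequentially"
      using ev
    proof eventually_elim
      case (elim n)
      then have "a * P n (Suc k) < P n (Suc (Suc k))" by (simp add: pos_less_divide_eq)
      with upper[of n "Suc k"] elim have "a * P n (Suc k) < X n * P n (Suc k)" by linarith
      then show ?case by (rule mult_right_less_imp_less) (use elim in auto)
    qed
  next
    fix b assume b: "r < b"
    \<comment> \<open>As r < b, the geometric bound \<open>s_le\<close> drops below b^(k+1) for some
      k; fixing this k reduces the claim to a (k+1)-th root.\<close>
    have "(\<lambda>k. s 1 / b * (r / b) ^ k) \<longlonglongrightarrow> s 1 / b * 0"
      using b r0 by (intro tendsto_mult tendsto_const LIMSEQ_power_zero) auto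
    then have "eventually (\<lambda>k. s 1 / b * (r / b) ^ k < 1) sequentially"
      by (rule order_tendstoD) simp
    then obtain k where k: "s 1 / b * (r / b) ^ k < 1" by (auto simp: eventually_sequentially)
    then have "s 1 * r ^ k < b ^ Suc k" using b r0 by (simp add: field_simps)
    with s_le[of k] have "s (Suc k) < b ^ Suc k" by linarith
    then have "eventually (\<lambda>n. P n (Suc k) < b ^ Suc k) sequentially"
      using lim[of "Suc k"] by (intro order_tendstoD(2)) auto
    then show "eventually (\<lambda>n. X n < b) sequentially"
      using ev
    proof eventually_elim
      case (elim n)
      then have "X n ^ Suc k < b ^ Suc k" using lower[of n "Suc k"] by simp
      then show ?case by (rule power_less_imp_less_base) (use b r0 in auto)
    qed
  qed
  with r0 show ?thesis by blast
qed

text \<open>The inequality behind the sign of the Wronskian's derivative in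
  \<open>R_less_large_alpha\<close>. With \<alpha> = 2 \<nu> + 1 the bound on \<mu> is (\<alpha>^2 +
  10 \<alpha> + 8) / 4. Substituting y = - ln x and bounding x^2 by 1 / (1 + 2 y) leaves an
  inequality linear in y and X.\<close>

lemma x_squared_bound:
  fixes x \<nu> \<mu> :: real
  assumes \<nu>: "\<nu> \<ge> 85" and x: "0 < x" "x < 1" and \<mu>: "\<mu> \<le> \<nu>\<^sup>2 + 6 * \<nu> + 19/4"
  shows "\<mu> * x\<^sup>2 * (1 - x powr \<nu>) < \<nu>\<^sup>2"
proof -
  define y where "y = - ln x"
  define X where "X = x powr \<nu>"
  define m where "m = \<nu>\<^sup>2 + 6 * \<nu> + 19/4"
  have y: "y > 0" using x by (simp add: y_def)
  have X: "X = exp (- (\<nu> * y))" using x by (simp add: X_def y_def powr_def)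
  have X1: "X < 1" using X y \<nu> by simp
  have x2: "x\<^sup>2 = exp (- (2 * y))" using x by (simp add: y_def exp_double)
  have x2y: "x\<^sup>2 * (1 + 2 * y) \<le> 1"
  proof -
    have "x\<^sup>2 * (1 + 2 * y) \<le> x\<^sup>2 * exp (2 * y)"
      by (intro mult_left_mono exp_ge_add_one_self) simp
    also have "\<dots> = 1" unfolding x2 by (simp flip: exp_add)
    finally show ?thesis .
  qed
  have "exp 3 = exp (1::real) ^ 3" by (simp flip: exp_of_nat_mult)
  also have "\<dots> \<le> 3 ^ 3" by (intro power_mono exp_le) simp
  finally have e3: "exp 3 \<le> (27::real)" by simp
  \<comment> \<open>The shift 3 yields the coefficient 8 = 2 * (3 + 1), and 8 \<nu> exceeds m -
    \<nu>^2 = 6 \<nu> + 19/4; the price 2 e^3 \<le> 54 is covered by \<nu> \<ge> 85.\<close>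
  have "2 * (4 - \<nu> * y) \<le> 2 * exp (3 - \<nu> * y)"
    using exp_ge_add_one_self[of "3 - \<nu> * y"] by simp
  also have "\<dots> = 2 * exp 3 * X" by (simp add: X exp_diff exp_minus field_simps)
  also have "\<dots> \<le> \<nu> * X" using e3 \<nu> by (intro mult_right_mono) (auto simp: X_def)
  finally have "\<nu> * (8 - 2 * (\<nu> * y)) \<le> \<nu> * (\<nu> * X)" using \<nu> by (intro mult_left_mono) auto
  then have "8 * \<nu> - 2 * \<nu>\<^sup>2 * y \<le> \<nu>\<^sup>2 * X" by (simp add: algebra_simps power2_eq_square)
  moreover have "\<nu>\<^sup>2 * X \<le> m * X" using \<nu> by (intro mult_right_mono) (auto simp: m_def X_def)
  moreover have "m * (1 - X) = m - m * X" "\<nu>\<^sup>2 * (1 + 2 * y) = \<nu>\<^sup>2 + 2 * \<nu>\<^sup>2 * y"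
    by (simp_all add: algebra_simps)
  ultimately have "m * (1 - X) < \<nu>\<^sup>2 * (1 + 2 * y)"
    using \<nu> m_def by linarith
  then have "x\<^sup>2 * (m * (1 - X)) < x\<^sup>2 * (\<nu>\<^sup>2 * (1 + 2 * y))"
    using x by (intro mult_strict_left_mono) auto
  also have "\<dots> = \<nu>\<^sup>2 * (x\<^sup>2 * (1 + 2 * y))" by simp
  also have "\<dots> \<le> \<nu>\<^sup>2" using mult_left_mono[OF x2y, of "\<nu>\<^sup>2"] by simp
  finally have "m * (x\<^sup>2 * (1 - X)) < \<nu>\<^sup>2" by (simp add: mult_ac)
  moreover have "\<mu> * (x\<^sup>2 * (1 - X)) \<le> m * (x\<^sup>2 * (1 - X))"
    using X1 \<mu> by (intro mult_right_mono) (auto simp: m_def)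
  ultimately show ?thesis by (simp add: X_def mult.assoc)
qed

subsection \<open>The discrete eigenvalue problem\<close>

locale laguerre =
  fixes \<alpha> :: real
  assumes alpha_gt: "\<alpha> > -1"
begin

text \<open>The squared norm of the \<open>k\<close>-th Laguerre polynomial divided by \<open>Gamma (\<alpha> + 1)\<close>.\<close>

definition h :: "nat \<Rightarrow> real" where
  "h k = pochhammer (\<alpha> + 1) k / fact k"

text \<open>The coefficients of the solution of \<open>u_rec\<close> below with \<open>u 0 \<mu> = 1\<close>, as a power series in \<open>-\<mu>\<close>.\<close>

primrec A :: "nat \<Rightarrow> nat \<Rightarrow> real" where
  "A 0 = (\<lambda>k. 1)"
| "A (Suc m) = (\<lambda>k. \<Sum>j<k. (\<Sum>i\<le>j. h i * A m i) / h (Suc j))"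

text \<open>Polymorphic in the field: reality of the roots is proved over the complex numbers, while
  the least root is located over the reals.\<close>

definition u :: "nat \<Rightarrow> 'a::real_normed_field \<Rightarrow> 'a" where
  "u k \<mu> = (\<Sum>m\<le>k. of_real (A m k) * (-\<mu>)^m)"

lemma h_pos: "h k > 0"
  using alpha_gt by (auto simp: h_def pochhammer_pos)

lemma h_neq_0 [simp]: "h k \<noteq> 0"
  using h_pos[of k] by simp

lemma h_0 [simp]: "h 0 = 1"
  by (simp add: h_def)

lemma h_Suc: "real (Suc k) * h (Suc k) = (\<alpha> + 1 + real k) * h k"
  by (simp add: h_def pochhammer_Suc divide_simps)

lemma A_nonneg: "A m k \<ge> 0"
  by (induction m arbitrary: k) (auto intro!: sum_nonneg divide_nonneg_pos mult_nonneg_nonneg h_pos less_imp_le[OF h_pos])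

lemma A_eq_0: "k < m \<Longrightarrow> A m k = 0"
  by (induction m arbitrary: k) (auto intro!: sum.neutral)

lemma u_altdef:
  assumes "k \<le> N"
  shows "u k \<mu> = (\<Sum>m\<le>N. of_real (A m k) * (-\<mu>)^m)"
  unfolding u_def using assms by (intro sum.mono_neutral_left) (auto simp: A_eq_0)

lemma u_0 [simp]: "u 0 \<mu> = 1"
  by (simp add: u_def)

lemma u_at_0 [simp]: "u n 0 = 1"
  by (simp add: u_def power_0_left if_distrib cong: if_cong)

text \<open>The Sturm-Liouville equation in once-summed form. Passing from \<open>k\<close> to
  \<open>Suc k\<close> adds exactly one summand to each \<open>A (Suc m)\<close>, and that summand
  is the right-hand side divided by \<open>h (Suc k)\<close>.\<close>

lemma u_rec:
  "of_real (h (Suc k)) * (u k \<mu> - u (Suc k) \<mu>) = \<mu> * (\<Sum>i\<le>k. of_real (h i) * u i \<mu>)"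
proof -
  have "u (Suc k) \<mu> = 1 + (\<Sum>m\<le>k. of_real (A (Suc m) (Suc k)) * (-\<mu>)^Suc m)"
    unfolding u_def by (subst sum.atMost_Suc_shift) simp
  \<comment> \<open>\<open>u k\<close> is padded by the vanishing coefficient
    \<open>A (Suc k) k\<close> so that both sums have the same range.\<close>
  moreover have "u k \<mu> = 1 + (\<Sum>m\<le>k. of_real (A (Suc m) k) * (-\<mu>)^Suc m)"
    unfolding u_altdef[OF le_SucI[OF order_refl], of k] by (subst sum.atMost_Suc_shift) simp
  ultimately have "u k \<mu> - u (Suc k) \<mu> =
      (\<Sum>m\<le>k. of_real (A (Suc m) k - A (Suc m) (Suc k)) * (-\<mu>)^Suc m)"
    by (simp add: sum_subtractf[symmetric] ring_distribs)
  also have "\<dots> = (\<Sum>m\<le>k. \<mu> * of_real ((\<Sum>i\<le>k. h i * A m i) / h (Suc k)) * (-\<mu>)^m)"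
    by (rule sum.cong) (simp_all add: algebra_simps)
  finally have "of_real (h (Suc k)) * (u k \<mu> - u (Suc k) \<mu>) =
      (\<Sum>m\<le>k. \<mu> * (\<Sum>i\<le>k. of_real (h i) * of_real (A m i)) * (-\<mu>)^m)"
    by (simp add: sum_distrib_left mult.assoc)
  also have "\<dots> = \<mu> * (\<Sum>m\<le>k. \<Sum>i\<le>k. of_real (h i) * (of_real (A m i) * (-\<mu>)^m))"
    by (simp add: sum_distrib_left sum_distrib_right mult.assoc)
  also have "\<dots> = \<mu> * (\<Sum>i\<le>k. of_real (h i) * u i \<mu>)"
    by (subst sum.swap) (simp add: sum_distrib_left[symmetric] u_altdef[symmetric])
  finally show ?thesis .
qed

text \<open>Summation by parts against an arbitrary test sequence: the conjugate of u gives real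
  roots, b^2 / u gives the Hardy inequality, and u itself gives the extremal polynomial.\<close>

lemma u_energy:
  "(\<Sum>k<n. of_real (h (Suc k)) * (u k \<mu> - u (Suc k) \<mu>) * (f k - f (Suc k)))
     = \<mu> * (\<Sum>k<n. of_real (h k) * u k \<mu> * f k) - \<mu> * (\<Sum>k<n. of_real (h k) * u k \<mu>) * f n"
proof -
  have "(\<Sum>k<n. of_real (h (Suc k)) * (u k \<mu> - u (Suc k) \<mu>) * (f k - f (Suc k)))
      = \<mu> * (\<Sum>k<n. (\<Sum>i\<le>k. of_real (h i) * u i \<mu>) * (f k - f (Suc k)))"
    unfolding u_rec by (simp add: sum_distrib_left[of \<mu> _ "{..<n}"] mult.assoc)
  also have "\<dots> = \<mu> * ((\<Sum>k<n. of_real (h k) * u k \<mu> * f k) - (\<Sum>k<n. of_real (h k) * u k \<mu>) * f n)"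
    by (rule arg_cong[OF sum_by_parts])
  finally show ?thesis by (simp only: right_diff_distrib mult.assoc)
qed

text \<open>Testing with the conjugate gives E = \<mu> N with E and N real; N > 0 because its first
  summand is 1.\<close>

lemma u_roots:
  fixes \<mu> :: complex
  assumes "u n \<mu> = 0"
  shows "\<mu> \<in> \<real>"
proof -
  have n: "n > 0" using assms by (cases n) auto
  define E where "E = (\<Sum>k<n. h (Suc k) * (norm (u k \<mu> - u (Suc k) \<mu>))\<^sup>2)"
  define N where "N = (\<Sum>k<n. h k * (norm (u k \<mu>))\<^sup>2)"
  have "of_real E = \<mu> * of_real N"
    using u_energy[of \<mu> "\<lambda>k. cnj (u k \<mu>)" n] assms unfolding E_def N_def
    by (simp add: complex_norm_square[symmetric] mult.assoc flip: complex_cnj_diff)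
  moreover have "N > 0" unfolding N_def
    using n by (intro sum_pos2[of _ 0]) (auto intro!: mult_nonneg_nonneg less_imp_le[OF h_pos])
  ultimately have "\<mu> = of_real (E / N)" by (simp add: field_simps)
  then show ?thesis by simp
qed

lemma continuous_u: "continuous_on S (u k)"
  unfolding u_def by (intro continuous_intros)

text \<open>Interlacing: at the least root of one member the recurrence makes the next member
  negative, so the next least root lies strictly to the left, where all earlier members are still
  positive.\<close>

lemma min_root:
  "\<exists>\<rho>>0. u (Suc n) \<rho> = 0 \<and> (\<forall>\<mu>\<in>{0..<\<rho>}. u (Suc n) \<mu> > 0)
     \<and> (\<forall>k\<le>n. \<forall>\<mu>\<in>{0..\<rho>::real}. u k \<mu> > 0)"
proof -
  have least: "\<exists>\<rho>>0. \<rho> < b \<and> u n \<rho> = 0 \<and> (\<forall>\<mu>\<in>{0..<\<rho>}. u n \<mu> > 0)"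
    if b: "0 < b" "u n b < 0" for b :: real and n
  proof -
    have c: "continuous_on S (\<lambda>x::real. u n x :: real)" for S by (rule continuous_u)
    \<comment> \<open>The zeros in the interval form a nonempty compact set and so have a least
      element; a nonpositive value before it would produce an earlier zero.\<close>
    define Z where "Z = {x\<in>{0..b}. u n x = (0::real)}"
    have "closed Z" unfolding Z_def
      by (intro continuous_closed_preimage_constant c closed_atLeastAtMost)
    moreover have "bounded Z" by (rule bounded_subset[OF bounded_closed_interval[of 0 b]]) (auto simp: Z_def)
    ultimately have cZ: "compact Z" by (simp add: compact_eq_bounded_closed)
    have "\<exists>x. 0 \<le> x \<and> x \<le> b \<and> u n x = (0::real)"
      using b by (intro IVT2') (auto intro: c)
    then have "Z \<noteq> {}" by (auto simp: Z_def)
    with cZ obtain \<rho> where \<rho>: "\<rho> \<in> Z" "\<And>x. x \<in> Z \<Longrightarrow> \<rho> \<le> x"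
      using compact_attains_inf by meson
    have pos: "u n \<mu> > 0" if "\<mu> \<in> {0..<\<rho>}" for \<mu>
    proof (rule ccontr)
      assume "\<not> ?thesis"
      then have "\<exists>x. 0 \<le> x \<and> x \<le> \<mu> \<and> u n x = (0::real)"
        using that by (intro IVT2') (auto intro: c)
      then obtain x where "0 \<le> x" "x \<le> \<mu>" "u n x = 0" by blast
      with that \<rho> have "x \<in> Z" by (auto simp: Z_def)
      from \<rho>(2)[OF this] \<open>x \<le> \<mu>\<close> that show False by auto
    qed
    have "\<rho> \<noteq> 0" "\<rho> \<noteq> b" using \<rho>(1) b by (auto simp: Z_def)
    with \<rho>(1) pos show ?thesis by (intro exI[of _ \<rho>]) (auto simp: Z_def)
  qed
  show ?thesis
  proof (induction n)
    case 0
    have "A (Suc 0) (Suc 0) > 0" using h_pos by simp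
    then show ?case
      by (intro exI[of _ "1 / A (Suc 0) (Suc 0)"]) (auto simp: u_def field_simps simp del: A.simps(2))
  next
    case (Suc n)
    then obtain \<rho> :: real where \<rho>: "\<rho> > 0" "u (Suc n) \<rho> = 0" "\<And>\<mu>. \<mu> \<in> {0..<\<rho>} \<Longrightarrow> u (Suc n) \<mu> > 0"
      "\<And>k \<mu>. k \<le> n \<Longrightarrow> \<mu> \<in> {0..\<rho>} \<Longrightarrow> u k \<mu> > 0" by blast
    have "h (Suc (Suc n)) * (- u (Suc (Suc n)) \<rho>) = \<rho> * (\<Sum>i\<le>Suc n. h i * u i \<rho>)"
      using u_rec[of "Suc n" \<rho>] \<rho>(2) by simp
    also have "\<dots> = \<rho> * (\<Sum>i\<le>n. h i * u i \<rho>)" using \<rho>(2) by simp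
    also have "\<dots> > 0" using \<rho> by (intro mult_pos_pos sum_pos h_pos) auto
    finally have "u (Suc (Suc n)) \<rho> < 0" using h_pos[of "Suc (Suc n)"] by (simp add: mult_less_0_iff)
    from least[OF \<rho>(1) this] obtain \<sigma> :: real where \<sigma>: "\<sigma> > 0" "\<sigma> < \<rho>" "u (Suc (Suc n)) \<sigma> = 0"
      "\<forall>\<mu>\<in>{0..<\<sigma>}. u (Suc (Suc n)) \<mu> > 0" by blast
    have "u k \<mu> > 0" if "k \<le> Suc n" "\<mu> \<in> {0..\<sigma>}" for k \<mu>
      using that \<rho>(3)[of \<mu>] \<rho>(4)[of k \<mu>] \<sigma>(2) by (cases "k \<le> n") (auto simp: le_Suc_eq)
    with \<sigma> show ?case by blast
  qed
qed

text \<open>Jacobi's argument: with the positive solution u, the left side equals the energy tested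
  with b^2 / u, and Picone bounds it term by term.\<close>

lemma hardy:
  fixes b :: "nat \<Rightarrow> real"
  assumes "u n \<rho> = 0" "\<And>k. k < n \<Longrightarrow> u k \<rho> > 0" "b n = 0"
  shows "\<rho> * (\<Sum>k<n. h k * (b k)\<^sup>2) \<le> (\<Sum>k<n. h (Suc k) * (b k - b (Suc k))\<^sup>2)"
proof -
  have "\<rho> * (\<Sum>k<n. h k * (b k)\<^sup>2) = \<rho> * (\<Sum>k<n. h k * u k \<rho> * ((b k)\<^sup>2 / u k \<rho>))"
    using assms(2) by (intro arg_cong[of _ _ "\<lambda>x. \<rho> * x"] sum.cong) (auto simp: less_imp_neq[symmetric])
  \<comment> \<open>The test sequence takes the value 0 / 0 = 0 at n, so no boundary term
    remains.\<close>
  also have "\<dots> = (\<Sum>k<n. h (Suc k) * ((u k \<rho> - u (Suc k) \<rho>) * ((b k)\<^sup>2 / u k \<rho> - (b (Suc k))\<^sup>2 / u (Suc k) \<rho>)))"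
    using u_energy[of \<rho> "\<lambda>k. (b k)\<^sup>2 / u k \<rho>" n] assms by (simp add: mult.assoc)
  also have "\<dots> \<le> (\<Sum>k<n. h (Suc k) * (b k - b (Suc k))\<^sup>2)"
  proof (intro sum_mono mult_left_mono picone less_imp_le[OF h_pos])
    fix k assume "k \<in> {..<n}"
    then show "u k \<rho> > 0" "u (Suc k) \<rho> > 0 \<or> u (Suc k) \<rho> = 0 \<and> b (Suc k) = 0"
      using assms by (auto simp: Suc_lessI le_less) (metis Suc_lessI)+
  qed
  finally show ?thesis .
qed

text \<open>The limits of the scaled coefficients of \<open>u n\<close>, which are the coefficients of \<open>\<phi>\<close>.\<close>

definition c :: "nat \<Rightarrow> real" where
  "c m = (-1) ^ m / (2 ^ m * fact m * (\<Prod>i<m. \<alpha> + 2 * real i + 1))"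

lemma c_0 [simp]: "c 0 = 1"
  by (simp add: c_def)

lemma c_Suc: "2 * real (Suc m) * (\<alpha> + 2 * real m + 1) * c (Suc m) = - c m"
proof -
  have "\<alpha> + 2 * real m + 1 \<noteq> 0" using alpha_gt by linarith
  then show ?thesis by (simp add: c_def divide_simps)
qed

text \<open>\<open>h\<close> is itself a generalised binomial coefficient. Hence the weighted sum in
  \<open>A\<close>, divided by the weight, sends one binomial coefficient to a multiple of the
  next.\<close>

lemma h_choose_sum:
  "(\<alpha> + 1 + real p) * (\<Sum>i<j. h i * real (i choose p)) = real (Suc p) * h j * real (j choose Suc p)"
proof (induction j)
  case (Suc j)
  have "real (Suc p) * h (Suc j) * real (Suc j choose Suc p) = h (Suc j) * (real (Suc j) * real (j choose p))"
  proof -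
    have "real (Suc p) * real (Suc j choose Suc p) = real (Suc j) * real (j choose p)"
      by (metis Suc_times_binomial of_nat_mult)
    then show ?thesis by (metis mult.assoc mult.left_commute)
  qed
  also have "\<dots> = (\<alpha> + 1 + real j) * h j * real (j choose p)"
    using h_Suc[of j] by (metis mult.assoc mult.left_commute)
  also have "\<dots> = (\<alpha> + 1 + real p) * (\<Sum>i<Suc j. h i * real (i choose p))"
    using arg_cong[OF Suc_times_binomial_real[of p j], of "\<lambda>x. h j * x"] Suc.IH by (simp add: algebra_simps)
  finally show ?case by simp
qed simp

text \<open>In the binomial basis each of the two summations raises the degree by one, so
  \<open>A m\<close> has degree 2 m in k. The top coefficient obeys the recurrence
  \<open>c_Suc\<close>.\<close>

lemma A_binomial_expansion:
  "\<exists>B. B (2 * m) = (-1) ^ m * fact (2 * m) * c m \<and> (\<forall>k. A m k = (\<Sum>p\<le>2*m. B p * real (k choose p)))"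
proof (induction m)
  case 0
  then show ?case by (intro exI[of _ "\<lambda>_. 1"]) simp
next
  case (Suc m)
  then obtain B where B: "B (2 * m) = (-1) ^ m * fact (2 * m) * c m"
    "\<And>k. A m k = (\<Sum>p\<le>2*m. B p * real (k choose p))" by blast
  define g where "g p = B p * real (Suc p) / (\<alpha> + 1 + real p)" for p
  have pos: "\<alpha> + 1 + real p > 0" for p using alpha_gt by linarith
  \<comment> \<open>Each term \<open>g p\<close> feeds both q = p + 2 and q = p + 1, as the
    hockey-stick identity below produces two binomials; the bound 2 m + 1 reflects p \<le> 2
    m.\<close>
  define B' where "B' q = (if 2 \<le> q then g (q - 2) else 0) + (if 1 \<le> q \<and> q \<le> 2 * m + 1 then g (q - 1) else 0)" for q
  have "B' (2 * Suc m) = B (2 * m) * real (Suc (2 * m)) / (\<alpha> + 2 * real m + 1)"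
    by (simp add: B'_def g_def add.commute add.left_commute)
  also have "\<dots> = (-1) ^ Suc m * fact (2 * Suc m) * c (Suc m)"
  proof -
    have "c m = - (2 * real (Suc m) * (\<alpha> + 2 * real m + 1) * c (Suc m))"
      using c_Suc[of m] by simp
    then show ?thesis using pos[of "2*m"] unfolding B(1) by (simp add: divide_simps) 
  qed
  finally have 1: "B' (2 * Suc m) = (-1) ^ Suc m * fact (2 * Suc m) * c (Suc m)" .
  have 2: "A (Suc m) k = (\<Sum>q\<le>2 * Suc m. B' q * real (k choose q))" for k
  proof -
    have hsum: "(\<Sum>i\<le>j. h i * real (i choose p)) / h (Suc j) = real (Suc p) / (\<alpha> + 1 + real p) * real (Suc j choose Suc p)" for j p
      using h_choose_sum[of p "Suc j"] pos[of p] by (simp add: lessThan_Suc_atMost field_simps)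
    have hockey: "(\<Sum>j<k. real (Suc j choose Suc p)) = real (k choose Suc (Suc p)) + real (k choose Suc p)" for p
      by (induction k) auto
    have "A (Suc m) k = (\<Sum>j<k. \<Sum>p\<le>2*m. B p * ((\<Sum>i\<le>j. h i * real (i choose p)) / h (Suc j)))"
      by (simp add: B(2) sum_distrib_left sum_divide_distrib)
         (subst sum.swap, simp add: mult_ac)
    also have "\<dots> = (\<Sum>p\<le>2*m. g p * (\<Sum>j<k. real (Suc j choose Suc p)))"
      unfolding hsum by (subst sum.swap) (simp add: g_def sum_distrib_left mult.assoc del: binomial_Suc_Suc)
    also have "\<dots> = (\<Sum>p\<le>2*m. g p * (real (k choose Suc (Suc p)) + real (k choose Suc p)))"
      unfolding hockey ..
    also have "(\<Sum>p\<le>2*m. g p * (real (k choose Suc (Suc p)) + real (k choose Suc p))) =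
       (\<Sum>q\<le>2 * Suc m. (if 2 \<le> q then g (q - 2) else 0) * real (k choose q)) +
       (\<Sum>q\<le>2 * Suc m. (if 1 \<le> q \<and> q \<le> 2 * m + 1 then g (q - 1) else 0) * real (k choose q))"
    proof -
      have "(\<Sum>q\<le>2 * Suc m. (if 2 \<le> q then g (q - 2) else 0) * real (k choose q)) = 
        (\<Sum>p\<le>2*m. g p * real (k choose Suc (Suc p)))"
        by (simp add: sum.atMost_Suc_shift del: sum.atMost_Suc binomial_Suc_Suc)
      moreover have "(\<Sum>q\<le>2 * Suc m. (if 1 \<le> q \<and> q \<le> 2 * m + 1 then g (q - 1) else 0) * real (k choose q)) =
        (\<Sum>p\<le>2*m. g p * real (k choose Suc p))"
      proof -
        have "(\<Sum>q\<le>2 * Suc m. (if 1 \<le> q \<and> q \<le> 2 * m + 1 then g (q - 1) else 0) * real (k choose q)) =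
          (\<Sum>q\<le>Suc (2 * m). (if 1 \<le> q \<and> q \<le> 2 * m + 1 then g (q - 1) else 0) * real (k choose q))"
          by simp
        then show ?thesis by (simp only: sum.atMost_Suc_shift) simp
      qed
      ultimately show ?thesis by (simp add: distrib_left sum.distrib del: binomial_Suc_Suc)
    qed
    also have "\<dots> = (\<Sum>q\<le>2 * Suc m. B' q * real (k choose q))"
      unfolding B'_def distrib_right sum.distrib ..
    finally show ?thesis .
  qed
  from 1 2 show ?case by blast
qed

lemma A_tendsto: "(\<lambda>n. (-1) ^ m * A m n / real n ^ (2 * m)) \<longlonglongrightarrow> c m"
proof -
  from A_binomial_expansion[of m] obtain B where B: "B (2 * m) = (-1) ^ m * fact (2 * m) * c m"
    "\<And>k. A m k = (\<Sum>p\<le>2*m. B p * real (k choose p))" by blast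
  have "(\<lambda>n. (-1) ^ m * (\<Sum>p\<le>2*m. B p * (real (n choose p) / real n ^ (2 * m)))) \<longlonglongrightarrow>
      (-1) ^ m * (\<Sum>p\<le>2*m. B p * (if p = 2 * m then 1 / fact (2 * m) else 0))"
    by (intro tendsto_intros binomial_over_higher_power_tendsto) auto
  also have "(\<Sum>p\<le>2*m. B p * (if p = 2 * m then 1 / fact (2 * m) else 0)) = (-1) ^ m * c m"
    by (simp add: B(1) if_distrib cong: if_cong)
  finally show ?thesis
    by (simp add: B(2) sum_divide_distrib[symmetric] flip: power_add mult.assoc mult_2)
qed

text \<open>The bound is \<open>A 1 k\<close> to the power m over m!, for \<open>A 1\<close> in
  closed form. Its factorial decay, after scaling by n^2, supplies the dominating series in
  \<open>phi_inverse_R\<close>.\<close>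

lemma A_le: "A m k \<le> (real k * real (Suc k) / (2 * (\<alpha> + 1))) ^ m / fact m"
proof (induction m arbitrary: k)
  case (Suc m)
  define P where "P k = real k * real (Suc k) / (2 * (\<alpha> + 1))" for k
  have a: "\<alpha> + 1 > 0" using alpha_gt by simp
  have P0: "P k \<ge> 0" for k using a by (simp add: P_def)
  have dP: "P (Suc k) - P k = real (Suc k) / (\<alpha> + 1)" for k
  proof -
    have "P (Suc k) - P k = (2 * real (Suc k)) / (2 * (\<alpha> + 1))"
      unfolding P_def diff_divide_distrib[symmetric] by (rule arg_cong2[of _ _ _ _ "(/)"]) (simp_all add: algebra_simps)
    then show ?thesis by (simp only: mult_divide_mult_cancel_left_if) simp
  qed
  have mono: "P i \<le> P k" if "i \<le> k" for i k
    using that a by (auto simp: P_def intro!: divide_right_mono mult_mono)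
  have "A (Suc m) k \<le> P k ^ Suc m / fact (Suc m)"
  proof (induction k)
    case 0
    then show ?case by (simp add: P_def)
  next
    case (Suc k)
    have "(\<Sum>i\<le>k. h i * A m i) \<le> (\<Sum>i\<le>k. h i * (P k ^ m / fact m))"
      using P0 mono Suc.IH \<open>\<And>k. A m k \<le> _\<close> unfolding P_def[symmetric]
      by (intro sum_mono mult_left_mono order.trans[OF \<open>\<And>k. A m k \<le> _\<close>[unfolded P_def[symmetric]]] divide_right_mono power_mono less_imp_le[OF h_pos]) auto
    also have "\<dots> = h (Suc k) * (P (Suc k) - P k) * (P k ^ m / fact m)"
    proof -
      have "(\<Sum>i\<le>k. h i) = h (Suc k) * (P (Suc k) - P k)"
        using h_choose_sum[of 0 "Suc k"] a unfolding dP by (simp add: lessThan_Suc_atMost field_simps)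
      then show ?thesis by (simp only: sum_distrib_right[symmetric])
    qed
    finally have "(\<Sum>i\<le>k. h i * A m i) / h (Suc k) \<le> (P (Suc k) - P k) * (P k ^ m / fact m)"
      using h_pos[of "Suc k"] by (simp add: field_simps)
    with Suc.IH have "A (Suc m) (Suc k) \<le> P k ^ Suc m / fact (Suc m) + (P (Suc k) - P k) * (P k ^ m / fact m)"
      by simp
    also have "\<dots> = (P k ^ Suc m + real (Suc m) * P k ^ m * (P (Suc k) - P k)) / fact (Suc m)"
      by (simp add: divide_simps)
    also have "\<dots> \<le> P (Suc k) ^ Suc m / fact (Suc m)"
      by (intro divide_right_mono power_tangent P0 mono) auto
    finally show ?case .
  qed
  then show ?case by (simp only: P_def)
qed simp

subsection \<open>Power sums of the eigenvalues\<close>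

definition charpoly :: "nat \<Rightarrow> real poly" where
  "charpoly n = (\<Sum>m\<le>n. monom ((-1) ^ m * A m n) m)"

lemma coeff_charpoly: "coeff (charpoly n) m = (-1) ^ m * A m n"
  by (simp add: charpoly_def coeff_sum A_eq_0)

lemma poly_charpoly: "poly (charpoly n) x = u n x"
  unfolding charpoly_def u_def poly_sum poly_monom
  by (intro sum.cong refl) (simp add: power_minus[of x])

lemma poly_charpoly_complex: "poly (map_poly of_real (charpoly n)) z = (u n z :: complex)"
proof -
  have "map_poly of_real (charpoly n) = (\<Sum>m\<le>n. monom (complex_of_real ((-1) ^ m * A m n)) m)"
    by (rule poly_eqI) (simp add: coeff_map_poly coeff_charpoly coeff_sum A_eq_0)
  then show ?thesis
    unfolding u_def by (simp add: poly_sum poly_monom)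
      (intro sum.cong refl, simp add: power_minus[of z])
qed

text \<open>The inverse roots of \<open>u n\<close>, with multiplicity.\<close>

definition eigs :: "nat \<Rightarrow> real multiset" where
  "eigs n = (SOME L. charpoly n = (\<Prod>x\<in>#L. [:1, -x:]) \<and> 0 \<notin># L)"

lemma eigs: "charpoly n = (\<Prod>x\<in>#eigs n. [:1, -x:])" and zero_notin_eigs: "0 \<notin># eigs n"
proof -
  have "\<exists>L. charpoly n = (\<Prod>x\<in>#L. [:1, -x:]) \<and> 0 \<notin># L"
    by (rule real_rooted_factorization) (auto simp: poly_charpoly poly_charpoly_complex u_roots)
  from someI_ex[OF this] show "charpoly n = (\<Prod>x\<in>#eigs n. [:1, -x:])" "0 \<notin># eigs n"
    by (auto simp: eigs_def)
qed

lemma u_eq_0_iff: "u n x = 0 \<longleftrightarrow> (\<exists>y\<in>#eigs n. x * y = 1)"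
proof -
  have "poly (\<Prod>x\<in>#L. [:1, -x:]) x = 0 \<longleftrightarrow> (\<exists>y\<in>#L. x * y = 1)" for L
    by (induction L) auto
  then show ?thesis by (simp add: eigs flip: poly_charpoly)
qed

text \<open>The least positive root of \<open>u n\<close>; the choice is meaningful for \<open>n > 0\<close> only.\<close>

definition rho :: "nat \<Rightarrow> real" where
  "rho n = (SOME \<rho>. \<rho> > 0 \<and> u n \<rho> = 0 \<and> (\<forall>\<mu>\<in>{0..<\<rho>}. u n \<mu> > 0) \<and> (\<forall>k<n. u k \<rho> > 0))"

lemma rho:
  assumes "n > 0"
  shows "rho n > 0" "u n (rho n) = 0" "0 \<le> \<mu> \<Longrightarrow> \<mu> < rho n \<Longrightarrow> u n \<mu> > 0"
    "k < n \<Longrightarrow> u k (rho n) > 0"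
proof -
  have "\<exists>\<rho>>0. u n \<rho> = 0 \<and> (\<forall>\<mu>\<in>{0..<\<rho>}. u n \<mu> > 0) \<and> (\<forall>k<n. u k \<rho> > (0::real))"
  proof -
    obtain k where k: "n = Suc k" using assms by (cases n) auto
    obtain \<rho> :: real where "\<rho> > 0" "u n \<rho> = 0" "\<forall>\<mu>\<in>{0..<\<rho>}. u n \<mu> > 0" "\<forall>j\<le>k. \<forall>\<mu>\<in>{0..\<rho>}. u j \<mu> > 0"
      using min_root[of k] k by blast
    then show ?thesis using k by (intro exI[of _ \<rho>]) auto
  qed
  from someI_ex[OF this] show "rho n > 0" "u n (rho n) = 0" "0 \<le> \<mu> \<Longrightarrow> \<mu> < rho n \<Longrightarrow> u n \<mu> > 0"
    "k < n \<Longrightarrow> u k (rho n) > 0" unfolding rho_def[symmetric] by simp_all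
qed

lemma inverse_rho_in_eigs:
  assumes "n > 0"
  shows "1 / rho n \<in># eigs n"
proof -
  from rho(1,2)[OF assms] obtain y where "y \<in># eigs n" "rho n * y = 1" by (auto simp: u_eq_0_iff)
  moreover from this rho(1)[OF assms] have "y = 1 / rho n" by (simp add: field_simps)
  ultimately show ?thesis by simp
qed

text \<open>The coefficients of u alternate in sign, so u is at least 1 at nonpositive arguments and
  all roots are positive; none lies below \<open>rho n\<close>.\<close>

lemma eigs_bounds:
  assumes "n > 0" "x \<in># eigs n"
  shows "x > 0" "x \<le> 1 / rho n"
proof -
  have x0: "x \<noteq> 0" using assms(2) zero_notin_eigs by metis
  have root: "u n (1 / x) = 0" using assms(2) x0 by (auto simp: u_eq_0_iff intro!: bexI[of _ x])
  show x: "x > 0"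
  proof (rule ccontr)
    assume "\<not> x > 0"
    then have "- (1 / x) \<ge> 0" by simp
    then have "u n (1 / x) \<ge> (\<Sum>m\<in>{0}. of_real (A m n) * (-(1/x)) ^ m)"
      unfolding u_def by (intro sum_mono2) (auto intro!: mult_nonneg_nonneg A_nonneg zero_le_power simp del: divide_minus_left minus_divide_right)
    with root show False by simp
  qed
  have "\<not> 1 / x < rho n" using rho(3)[OF assms(1), of "1 / x"] root x by auto
  then show "x \<le> 1 / rho n" using x rho(1)[OF assms(1)] by (simp add: field_simps)
qed

text \<open>For n > 0 this is the square of \<open>markov_constant \<alpha> n / n\<close>, by
  \<open>markov_constant_eq\<close>.\<close>

definition top_eig :: "nat \<Rightarrow> real" where
  "top_eig n = 1 / rho n / real n ^ 2"

definition power_sum :: "nat \<Rightarrow> nat \<Rightarrow> real" where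
  "power_sum n k = (\<Sum>x\<in>#eigs n. (x / real n ^ 2) ^ k)"

text \<open>Meaningful for k > 0; at k = 0 the power sum merely counts the roots.\<close>

definition s :: "nat \<Rightarrow> real" where
  "s k = lim (\<lambda>n. power_sum n k)"

definition scaled_eigs :: "nat \<Rightarrow> real multiset" where
  "scaled_eigs n = image_mset (\<lambda>x. x / real n ^ 2) (eigs n)"

lemma power_sum_altdef: "power_sum n k = (\<Sum>x\<in>#scaled_eigs n. x ^ k)"
  by (simp add: power_sum_def scaled_eigs_def multiset.map_comp o_def)

lemma top_eig_in_scaled_eigs: "n > 0 \<Longrightarrow> top_eig n \<in># scaled_eigs n"
  unfolding scaled_eigs_def top_eig_def set_image_mset by (intro imageI inverse_rho_in_eigs)

lemma top_eig_pos: "n > 0 \<Longrightarrow> top_eig n > 0"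
  by (simp add: top_eig_def rho(1))

lemma scaled_eigs_bounds: "n > 0 \<Longrightarrow> x \<in># scaled_eigs n \<Longrightarrow> 0 < x \<and> x \<le> top_eig n"
  using eigs_bounds unfolding scaled_eigs_def top_eig_def
  by (auto simp del: divide_divide_eq_left intro!: divide_right_mono)

text \<open>Newton's identity solved for the newest power sum, with every coefficient divided by its
  own power of n^2 so that all factors have limits.\<close>

lemma power_sum_rec:
  assumes "n > 0"
  shows "power_sum n (Suc m) = - real (Suc m) * ((-1) ^ Suc m * A (Suc m) n / real n ^ (2 * Suc m))
    - (\<Sum>i<m. power_sum n (Suc i) * ((-1) ^ (m - i) * A (m - i) n / real n ^ (2 * (m - i))))"
proof -
  define N where "N = real n ^ 2"
  have N: "N \<noteq> 0" using assms by (simp add: N_def)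
  have S: "(\<Sum>x\<in>#eigs n. x ^ k) = N ^ k * power_sum n k" for k
    using N by (simp add: power_sum_def N_def sum_mset_distrib_left power_divide)
  define a where "a m = (-1) ^ m * A m n / N ^ m" for m
  have cf: "coeff (charpoly n) m = N ^ m * a m" for m
    using N by (simp add: coeff_charpoly a_def)
  have "real (Suc m) * (N ^ Suc m * a (Suc m)) = - (\<Sum>i\<le>m. N ^ Suc i * power_sum n (Suc i) * (N ^ (m - i) * a (m - i)))"
    using newton_identities[OF eigs, of m n] unfolding S cf .
  also have "\<dots> = - (\<Sum>i\<le>m. N ^ Suc m * (power_sum n (Suc i) * a (m - i)))"
    by (intro arg_cong[of _ _ uminus] sum.cong refl)
       (simp add: algebra_simps flip: power_add)
  also have "\<dots> = N ^ Suc m * - (\<Sum>i\<le>m. power_sum n (Suc i) * a (m - i))"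
    by (simp only: sum_distrib_left mult_minus_right)
  finally have "N ^ Suc m * (real (Suc m) * a (Suc m)) = N ^ Suc m * - (\<Sum>i\<le>m. power_sum n (Suc i) * a (m - i))"
    by (simp only: mult.left_commute)
  then have "real (Suc m) * a (Suc m) = - (\<Sum>i\<le>m. power_sum n (Suc i) * a (m - i))"
    using N by (simp only: mult_left_cancel[OF power_not_zero[OF N]])
  also have "\<dots> = - power_sum n (Suc m) - (\<Sum>i<m. power_sum n (Suc i) * a (m - i))"
    by (simp add: lessThan_Suc_atMost[symmetric] a_def)
  finally have "power_sum n (Suc m) = - real (Suc m) * a (Suc m) - (\<Sum>i<m. power_sum n (Suc i) * a (m - i))"
    by linarith
  then show ?thesis by (simp only: a_def N_def power_mult)
qed

lemma power_sum_limit: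
  "(\<lambda>n. power_sum n (Suc m)) \<longlonglongrightarrow> s (Suc m) \<and> 
     s (Suc m) = - real (Suc m) * c (Suc m) - (\<Sum>i<m. s (Suc i) * c (m - i))"
proof (induction m rule: less_induct)
  case (less m)
  have "(\<lambda>n. - real (Suc m) * ((-1) ^ Suc m * A (Suc m) n / real n ^ (2 * Suc m))
    - (\<Sum>i<m. power_sum n (Suc i) * ((-1) ^ (m - i) * A (m - i) n / real n ^ (2 * (m - i))))) \<longlonglongrightarrow>
    - real (Suc m) * c (Suc m) - (\<Sum>i<m. s (Suc i) * c (m - i))"
    using less[THEN conjunct1] by (intro tendsto_intros A_tendsto) auto
  moreover have "eventually (\<lambda>n. - real (Suc m) * ((-1) ^ Suc m * A (Suc m) n / real n ^ (2 * Suc m))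
    - (\<Sum>i<m. power_sum n (Suc i) * ((-1) ^ (m - i) * A (m - i) n / real n ^ (2 * (m - i)))) = power_sum n (Suc m)) sequentially"
    using eventually_gt_at_top[of 0] by eventually_elim (rule power_sum_rec[symmetric])
  ultimately have L: "(\<lambda>n. power_sum n (Suc m)) \<longlonglongrightarrow> - real (Suc m) * c (Suc m) - (\<Sum>i<m. s (Suc i) * c (m - i))"
    by (rule Lim_transform_eventually)
  moreover from L have "s (Suc m) = - real (Suc m) * c (Suc m) - (\<Sum>i<m. s (Suc i) * c (m - i))"
    unfolding s_def by (rule limI)
  ultimately show ?case by metis
qed

lemma power_sum_tendsto: "k > 0 \<Longrightarrow> (\<lambda>n. power_sum n k) \<longlonglongrightarrow> s k"
  using power_sum_limit[of "k - 1", THEN conjunct1] by simp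

lemma s_rec: "s (Suc m) = - real (Suc m) * c (Suc m) - (\<Sum>i<m. s (Suc i) * c (m - i))"
  using power_sum_limit by blast

text \<open>The limiting Newton identities solved successively; these are Rayleigh's sums.\<close>

lemma s_explicit:
  "s 1 = 1 / (2 * (\<alpha> + 1))"
  "s 2 = 1 / (2 * (\<alpha> + 1)^2 * (\<alpha> + 3))"
  "s 3 = 1 / ((\<alpha> + 1)^3 * (\<alpha> + 3) * (\<alpha> + 5))"
  "s 4 = (5 * \<alpha> + 17) / (2 * (\<alpha> + 1)^4 * (\<alpha> + 3)^2 * (\<alpha> + 5) * (\<alpha> + 7))"
  "s 5 = (7 * \<alpha> + 31) / ((\<alpha> + 1)^5 * (\<alpha> + 3)^2 * (\<alpha> + 5) * (\<alpha> + 7) * (\<alpha> + 9))"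
  "s 6 = (21 * \<alpha>^3 + 299 * \<alpha>^2 + 1391 * \<alpha> + 2073) /
     ((\<alpha> + 1)^6 * (\<alpha> + 3)^3 * (\<alpha> + 5)^2 * (\<alpha> + 7) * (\<alpha> + 9) * (\<alpha> + 11))"
proof -
  define p q r t v w where pqrtvw: "p = \<alpha> + 1" "q = \<alpha> + 3" "r = \<alpha> + 5" "t = \<alpha> + 7" "v = \<alpha> + 9" "w = \<alpha> + 11"
  have nz: "p \<noteq> 0" "q \<noteq> 0" "r \<noteq> 0" "t \<noteq> 0" "v \<noteq> 0" "w \<noteq> 0"
    using alpha_gt unfolding pqrtvw by linarith+
  have a: "q = p + 2" "r = p + 4" "t = p + 6" "v = p + 8" "w = p + 10" "\<alpha> = p - 1"
    unfolding pqrtvw by simp_all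
  have c: "c 1 = - 1 / (2 * p)" "c 2 = 1 / (8 * p * q)" "c 3 = - 1 / (48 * p * q * r)"
    "c 4 = 1 / (384 * p * q * r * t)" "c 5 = - 1 / (3840 * p * q * r * t * v)"
    "c 6 = 1 / (46080 * p * q * r * t * v * w)"
    unfolding pqrtvw by (simp_all add: c_def fact_numeral eval_nat_numeral lessThan_Suc ac_simps) (simp_all add: algebra_simps)
  have r: "s 1 = - 1 * c 1"
    "s 2 = - 2 * c 2 - s 1 * c 1"
    "s 3 = - 3 * c 3 - s 1 * c 2 - s 2 * c 1"
    "s 4 = - 4 * c 4 - s 1 * c 3 - s 2 * c 2 - s 3 * c 1"
    "s 5 = - 5 * c 5 - s 1 * c 4 - s 2 * c 3 - s 3 * c 2 - s 4 * c 1"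
    "s 6 = - 6 * c 6 - s 1 * c 5 - s 2 * c 4 - s 3 * c 3 - s 4 * c 2 - s 5 * c 1"
    using s_rec[of 0] s_rec[of 1] s_rec[of 2] s_rec[of 3] s_rec[of 4] s_rec[of 5]
    by (simp_all add: eval_nat_numeral lessThan_Suc)
  \<comment> \<open>The pattern for every index: bring all products over the denominator of the
    result, then expand the numerator as a polynomial in p.\<close>
  have t0: "c 1 = (- 1 / 2) * (1) / (p)"
    unfolding c using nz by (simp add: field_simps eval_nat_numeral)
  have "s 1 = (- 1 * (- 1 / 2) * (1)) / (p)"
    unfolding r(1) t0 by (simp only: diff_divide_distrib add_divide_distrib diff_diff_eq[symmetric] times_divide_eq_right mult.assoc)
  also have "(- 1 * (- 1 / 2) * (1) :: real) = 1 / 2"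
    unfolding a by (simp add: eval_nat_numeral algebra_simps add_divide_distrib diff_divide_distrib)
  finally have s1: "s 1 = (1 / 2) / (p)" .
  have t0: "c 2 = (1 / 8) * (p) / (p^2 * q)"
    unfolding c using nz by (simp add: field_simps eval_nat_numeral)
  have t1: "s 1 * c 1 = (1 / 2) * (- 1 / 2) * (q) / (p^2 * q)"
    unfolding s1 c using nz by (simp add: field_simps eval_nat_numeral)
  have "s 2 = (- 2 * (1 / 8) * (p) - (1 / 2) * (- 1 / 2) * (q)) / (p^2 * q)"
    unfolding r(2) t0 t1 by (simp only: diff_divide_distrib add_divide_distrib diff_diff_eq[symmetric] times_divide_eq_right mult.assoc)
  also have "(- 2 * (1 / 8) * (p) - (1 / 2) * (- 1 / 2) * (q) :: real) = 1 / 2"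
    unfolding a by (simp add: eval_nat_numeral algebra_simps add_divide_distrib diff_divide_distrib)
  finally have s2: "s 2 = (1 / 2) / (p^2 * q)" .
  have t0: "c 3 = (- 1 / 48) * (p^2) / (p^3 * q * r)"
    unfolding c using nz by (simp add: field_simps eval_nat_numeral)
  have t1: "s 1 * c 2 = (1 / 2) * (1 / 8) * (p * r) / (p^3 * q * r)"
    unfolding s1 c using nz by (simp add: field_simps eval_nat_numeral)
  have t2: "s 2 * c 1 = (1 / 2) * (- 1 / 2) * (r) / (p^3 * q * r)"
    unfolding s2 c using nz by (simp add: field_simps eval_nat_numeral)
  have "s 3 = (- 3 * (- 1 / 48) * (p^2) - (1 / 2) * (1 / 8) * (p * r) - (1 / 2) * (- 1 / 2) * (r)) / (p^3 * q * r)"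
    unfolding r(3) t0 t1 t2 by (simp only: diff_divide_distrib add_divide_distrib diff_diff_eq[symmetric] times_divide_eq_right mult.assoc)
  also have "(- 3 * (- 1 / 48) * (p^2) - (1 / 2) * (1 / 8) * (p * r) - (1 / 2) * (- 1 / 2) * (r) :: real) = 1"
    unfolding a by (simp add: eval_nat_numeral algebra_simps add_divide_distrib diff_divide_distrib)
  finally have s3: "s 3 = (1) / (p^3 * q * r)" .
  have t0: "c 4 = (1 / 384) * (p^3 * q) / (p^4 * q^2 * r * t)"
    unfolding c using nz by (simp add: field_simps eval_nat_numeral)
  have t1: "s 1 * c 3 = (1 / 2) * (- 1 / 48) * (p^2 * q * t) / (p^4 * q^2 * r * t)"
    unfolding s1 c using nz by (simp add: field_simps eval_nat_numeral)
  have t2: "s 2 * c 2 = (1 / 2) * (1 / 8) * (p * r * t) / (p^4 * q^2 * r * t)"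
    unfolding s2 c using nz by (simp add: field_simps eval_nat_numeral)
  have t3: "s 3 * c 1 = (1) * (- 1 / 2) * (q * t) / (p^4 * q^2 * r * t)"
    unfolding s3 c using nz by (simp add: field_simps eval_nat_numeral)
  have "s 4 = (- 4 * (1 / 384) * (p^3 * q) - (1 / 2) * (- 1 / 48) * (p^2 * q * t) - (1 / 2) * (1 / 8) * (p * r * t) - (1) * (- 1 / 2) * (q * t)) / (p^4 * q^2 * r * t)"
    unfolding r(4) t0 t1 t2 t3 by (simp only: diff_divide_distrib add_divide_distrib diff_diff_eq[symmetric] times_divide_eq_right mult.assoc)
  also have "(- 4 * (1 / 384) * (p^3 * q) - (1 / 2) * (- 1 / 48) * (p^2 * q * t) - (1 / 2) * (1 / 8) * (p * r * t) - (1) * (- 1 / 2) * (q * t) :: real) = (5 * \<alpha> + 17) / 2"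
    unfolding a by (simp add: eval_nat_numeral algebra_simps add_divide_distrib diff_divide_distrib)
  finally have s4: "s 4 = ((5 * \<alpha> + 17) / 2) / (p^4 * q^2 * r * t)" .
  have t0: "c 5 = (- 1 / 3840) * (p^4 * q) / (p^5 * q^2 * r * t * v)"
    unfolding c using nz by (simp add: field_simps eval_nat_numeral)
  have t1: "s 1 * c 4 = (1 / 2) * (1 / 384) * (p^3 * q * v) / (p^5 * q^2 * r * t * v)"
    unfolding s1 c using nz by (simp add: field_simps eval_nat_numeral)
  have t2: "s 2 * c 3 = (1 / 2) * (- 1 / 48) * (p^2 * t * v) / (p^5 * q^2 * r * t * v)"
    unfolding s2 c using nz by (simp add: field_simps eval_nat_numeral)
  have t3: "s 3 * c 2 = (1) * (1 / 8) * (p * t * v) / (p^5 * q^2 * r * t * v)"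
    unfolding s3 c using nz by (simp add: field_simps eval_nat_numeral)
  have t4: "s 4 * c 1 = ((5 * \<alpha> + 17) / 2) * (- 1 / 2) * (v) / (p^5 * q^2 * r * t * v)"
    unfolding s4 c using nz by (simp add: field_simps eval_nat_numeral)
  have "s 5 = (- 5 * (- 1 / 3840) * (p^4 * q) - (1 / 2) * (1 / 384) * (p^3 * q * v) - (1 / 2) * (- 1 / 48) * (p^2 * t * v) - (1) * (1 / 8) * (p * t * v) - ((5 * \<alpha> + 17) / 2) * (- 1 / 2) * (v)) / (p^5 * q^2 * r * t * v)"
    unfolding r(5) t0 t1 t2 t3 t4 by (simp only: diff_divide_distrib add_divide_distrib diff_diff_eq[symmetric] times_divide_eq_right mult.assoc)
  also have "(- 5 * (- 1 / 3840) * (p^4 * q) - (1 / 2) * (1 / 384) * (p^3 * q * v) - (1 / 2) * (- 1 / 48) * (p^2 * t * v) - (1) * (1 / 8) * (p * t * v) - ((5 * \<alpha> + 17) / 2) * (- 1 / 2) * (v) :: real) = 7 * \<alpha> + 31"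
    unfolding a by (simp add: eval_nat_numeral algebra_simps add_divide_distrib diff_divide_distrib)
  finally have s5: "s 5 = (7 * \<alpha> + 31) / (p^5 * q^2 * r * t * v)" .
  have t0: "c 6 = (1 / 46080) * (p^5 * q^2 * r) / (p^6 * q^3 * r^2 * t * v * w)"
    unfolding c using nz by (simp add: field_simps eval_nat_numeral)
  have t1: "s 1 * c 5 = (1 / 2) * (- 1 / 3840) * (p^4 * q^2 * r * w) / (p^6 * q^3 * r^2 * t * v * w)"
    unfolding s1 c using nz by (simp add: field_simps eval_nat_numeral)
  have t2: "s 2 * c 4 = (1 / 2) * (1 / 384) * (p^3 * q * r * v * w) / (p^6 * q^3 * r^2 * t * v * w)"
    unfolding s2 c using nz by (simp add: field_simps eval_nat_numeral)
  have t3: "s 3 * c 3 = (1) * (- 1 / 48) * (p^2 * q * t * v * w) / (p^6 * q^3 * r^2 * t * v * w)"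
    unfolding s3 c using nz by (simp add: field_simps eval_nat_numeral)
  have t4: "s 4 * c 2 = ((5 * \<alpha> + 17) / 2) * (1 / 8) * (p * r * v * w) / (p^6 * q^3 * r^2 * t * v * w)"
    unfolding s4 c using nz by (simp add: field_simps eval_nat_numeral)
  have t5: "s 5 * c 1 = (7 * \<alpha> + 31) * (- 1 / 2) * (q * r * w) / (p^6 * q^3 * r^2 * t * v * w)"
    unfolding s5 c using nz by (simp add: field_simps eval_nat_numeral)
  have "s 6 = (- 6 * (1 / 46080) * (p^5 * q^2 * r) - (1 / 2) * (- 1 / 3840) * (p^4 * q^2 * r * w) - (1 / 2) * (1 / 384) * (p^3 * q * r * v * w) - (1) * (- 1 / 48) * (p^2 * q * t * v * w) - ((5 * \<alpha> + 17) / 2) * (1 / 8) * (p * r * v * w) - (7 * \<alpha> + 31) * (- 1 / 2) * (q * r * w)) / (p^6 * q^3 * r^2 * t * v * w)"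
    unfolding r(6) t0 t1 t2 t3 t4 t5 by (simp only: diff_divide_distrib add_divide_distrib diff_diff_eq[symmetric] times_divide_eq_right mult.assoc)
  also have "(- 6 * (1 / 46080) * (p^5 * q^2 * r) - (1 / 2) * (- 1 / 3840) * (p^4 * q^2 * r * w) - (1 / 2) * (1 / 384) * (p^3 * q * r * v * w) - (1) * (- 1 / 48) * (p^2 * q * t * v * w) - ((5 * \<alpha> + 17) / 2) * (1 / 8) * (p * r * v * w) - (7 * \<alpha> + 31) * (- 1 / 2) * (q * r * w) :: real) = 21 * \<alpha>^3 + 299 * \<alpha>^2 + 1391 * \<alpha> + 2073"
    unfolding a by (simp add: eval_nat_numeral algebra_simps add_divide_distrib diff_divide_distrib)
  finally have s6: "s 6 = (21 * \<alpha>^3 + 299 * \<alpha>^2 + 1391 * \<alpha> + 2073) / (p^6 * q^3 * r^2 * t * v * w)" .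
  show "s 1 = 1 / (2 * (\<alpha> + 1))"
    "s 2 = 1 / (2 * (\<alpha> + 1)^2 * (\<alpha> + 3))"
    "s 3 = 1 / ((\<alpha> + 1)^3 * (\<alpha> + 3) * (\<alpha> + 5))"
    "s 4 = (5 * \<alpha> + 17) / (2 * (\<alpha> + 1)^4 * (\<alpha> + 3)^2 * (\<alpha> + 5) * (\<alpha> + 7))"
    "s 5 = (7 * \<alpha> + 31) / ((\<alpha> + 1)^5 * (\<alpha> + 3)^2 * (\<alpha> + 5) * (\<alpha> + 7) * (\<alpha> + 9))"
    "s 6 = (21 * \<alpha>^3 + 299 * \<alpha>^2 + 1391 * \<alpha> + 2073) /
     ((\<alpha> + 1)^6 * (\<alpha> + 3)^3 * (\<alpha> + 5)^2 * (\<alpha> + 7) * (\<alpha> + 9) * (\<alpha> + 11))"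
    unfolding s1 s2 s3 s4 s5 s6 unfolding pqrtvw by (simp_all add: mult.assoc)
qed

section \<open>Log-convexity of the power sums and the limit of the largest scaled inverse
  root\<close>

lemma scaled_eigs_split:
  assumes "n > 0"
  obtains L where "scaled_eigs n = add_mset (top_eig n) L" "\<And>x. x \<in># L \<Longrightarrow> 0 < x \<and> x \<le> top_eig n"
proof
  show "scaled_eigs n = add_mset (top_eig n) (scaled_eigs n - {#top_eig n#})" using top_eig_in_scaled_eigs[OF assms] by simp
  show "\<And>x. x \<in># scaled_eigs n - {#top_eig n#} \<Longrightarrow> 0 < x \<and> x \<le> top_eig n"
    using scaled_eigs_bounds[OF assms] by (blast dest: in_diffD)
qed

text \<open>Removing one copy of the largest element leaves power sums of positive numbers.\<close>

lemma power_sum_minus_top_eig_power: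
  assumes "n > 0"
  shows "0 \<le> power_sum n k - top_eig n ^ k"
    "(power_sum n (Suc k) - top_eig n ^ Suc k)\<^sup>2 \<le> (power_sum n k - top_eig n ^ k) * (power_sum n (Suc (Suc k)) - top_eig n ^ Suc (Suc k))"
proof -
  obtain L where L: "scaled_eigs n = add_mset (top_eig n) L" "\<And>x. x \<in># L \<Longrightarrow> 0 < x \<and> x \<le> top_eig n"
    using scaled_eigs_split[OF assms] by blast
  have *: "power_sum n k - top_eig n ^ k = (\<Sum>x\<in>#L. x ^ k)" for k
    by (simp add: power_sum_altdef L(1))
  show "0 \<le> power_sum n k - top_eig n ^ k" unfolding * using L(2) by (intro sum_mset_nonneg' zero_le_power) (auto dest: less_imp_le)
  show "(power_sum n (Suc k) - top_eig n ^ Suc k)\<^sup>2 \<le> (power_sum n k - top_eig n ^ k) * (power_sum n (Suc (Suc k)) - top_eig n ^ Suc (Suc k))"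
    unfolding * using sum_mset_log_convex[of L "\<lambda>_. 1" k] L(2) by (auto dest: less_imp_le)
qed

text \<open>These are power sums with the nonnegative weight \<open>top_eig n - x\<close>.\<close>

lemma top_eig_times_power_sum_minus:
  assumes "n > 0"
  shows "0 \<le> top_eig n * power_sum n k - power_sum n (Suc k)"
    "(top_eig n * power_sum n (Suc k) - power_sum n (Suc (Suc k)))\<^sup>2 \<le>
      (top_eig n * power_sum n k - power_sum n (Suc k)) * (top_eig n * power_sum n (Suc (Suc k)) - power_sum n (Suc (Suc (Suc k))))"
proof -
  have *: "top_eig n * power_sum n k - power_sum n (Suc k) = (\<Sum>x\<in>#scaled_eigs n. (top_eig n - x) * x ^ k)" for k
  proof -
    have "(\<Sum>x\<in>#L. (y - x) * x ^ k) = y * (\<Sum>x\<in>#L. x ^ k) - (\<Sum>x\<in>#L. x ^ Suc k)" for L and y :: real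
      by (induction L) (auto simp: algebra_simps)
    then show ?thesis by (simp add: power_sum_altdef)
  qed
  note L = scaled_eigs_bounds[OF assms]
  show "0 \<le> top_eig n * power_sum n k - power_sum n (Suc k)" unfolding *
    using L by (intro sum_mset_nonneg' mult_nonneg_nonneg zero_le_power) (auto dest: less_imp_le)
  show "(top_eig n * power_sum n (Suc k) - power_sum n (Suc (Suc k)))\<^sup>2 \<le>
      (top_eig n * power_sum n k - power_sum n (Suc k)) * (top_eig n * power_sum n (Suc (Suc k)) - power_sum n (Suc (Suc (Suc k))))"
    unfolding * using sum_mset_log_convex[of "scaled_eigs n" "\<lambda>x. top_eig n - x" k] L by (auto dest: less_imp_le)
qed

lemma power_sum_log_convex:
  assumes "n > 0"
  shows "(power_sum n (Suc k))\<^sup>2 \<le> power_sum n k * power_sum n (Suc (Suc k))"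
  unfolding power_sum_altdef using sum_mset_log_convex[of "scaled_eigs n" "\<lambda>_. 1" k] scaled_eigs_bounds[OF assms]
  by (auto dest: less_imp_le)

lemma s_log_convex:
  assumes "k > 0"
  shows "(s (Suc k))\<^sup>2 \<le> s k * s (Suc (Suc k))"
  by (rule LIMSEQ_le_if_pos_index[OF power_sum_log_convex]) (auto intro!: tendsto_intros power_sum_tendsto assms)

text \<open>Log-convexity carries positivity upwards from the explicit first two sums.\<close>

lemma s_pos:
  assumes "k > 0"
  shows "s k > 0"
proof -
  have "s (Suc k) > 0 \<and> s (Suc (Suc k)) > 0" for k
  proof (induction k)
    case 0
    then show ?case using s_explicit(1,2) alpha_gt by (simp add: numeral_2_eq_2)
  next
    case (Suc k)
    then have "0 < (s (Suc (Suc k)))\<^sup>2" by simp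
    also have "\<dots> \<le> s (Suc k) * s (Suc (Suc (Suc k)))" by (rule s_log_convex) simp
    finally show ?case using Suc by (simp add: zero_less_mult_iff)
  qed
  from this[of "k - 1"] assms show ?thesis by simp
qed

text \<open>The square of the asymptotic Markov constant, by
  \<open>markov_constant_tendsto\<close>.\<close>

definition R :: real where "R = lim top_eig"

lemma top_eig_tendsto: "top_eig \<longlonglongrightarrow> R" and R_pos: "R > 0"
proof -
  have "\<exists>r>0. top_eig \<longlonglongrightarrow> r"
    by (rule max_tendsto_of_moments[of power_sum s])
       (use power_sum_minus_top_eig_power(1) top_eig_times_power_sum_minus(1) in \<open>auto intro: power_sum_tendsto s_log_convex s_pos less_imp_le[OF top_eig_pos]\<close>)
  then show "top_eig \<longlonglongrightarrow> R" "R > 0" by (auto simp: R_def dest: limI)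
qed

lemma s_minus_R_power:
  assumes "k > 0"
  shows "0 \<le> s k - R ^ k"
    "(s (Suc k) - R ^ Suc k)\<^sup>2 \<le> (s k - R ^ k) * (s (Suc (Suc k)) - R ^ Suc (Suc k))"
  by (rule LIMSEQ_le_if_pos_index[OF power_sum_minus_top_eig_power(1)] LIMSEQ_le_if_pos_index[OF power_sum_minus_top_eig_power(2)],
      auto intro!: tendsto_intros power_sum_tendsto top_eig_tendsto assms simp del: power_Suc)+

lemma R_times_s_minus_s:
  assumes "k > 0"
  shows "0 \<le> R * s k - s (Suc k)"
    "(R * s (Suc k) - s (Suc (Suc k)))\<^sup>2 \<le> (R * s k - s (Suc k)) * (R * s (Suc (Suc k)) - s (Suc (Suc (Suc k))))"
  by (rule LIMSEQ_le_if_pos_index[OF top_eig_times_power_sum_minus(1)] LIMSEQ_le_if_pos_index[OF top_eig_times_power_sum_minus(2)],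
      auto intro!: tendsto_intros power_sum_tendsto top_eig_tendsto assms)+

text \<open>Limits give only the weak inequality. Equality would make the log-convex sequence
  \<open>s k - R ^ k\<close> vanish at 2 and 3, so that both s2^3 and s3^2 equal R^6; their
  reciprocals differ by a positive multiple of p^2.\<close>

lemma R_upper: "R ^ 6 < s 6"
proof -
  let ?t = "\<lambda>k. s k - R ^ k"
  have "?t 6 \<noteq> 0"
  proof
    assume 6: "?t 6 = 0"
    have "?t 2 = 0" "?t 3 = 0"
      using log_convex_zero_down[of ?t 2 4] log_convex_zero_down[of ?t 3 3] s_minus_R_power(2) 6 by simp_all
    then have "s 2 ^ 3 = s 3 ^ 2" by simp
    moreover have "s 2 ^ 3 \<noteq> s 3 ^ 2"
    proof -
      define p where "p = \<alpha> + 1"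
      have p: "p > 0" using alpha_gt by (simp add: p_def)
      have "s 2 = 1 / (2 * p^2 * (p + 2))" "s 3 = 1 / (p^3 * (p + 2) * (p + 4))"
        unfolding s_explicit p_def by (simp_all add: add.assoc)
      moreover have "(p^3 * (p + 2) * (p + 4))^2 \<noteq> (2 * p^2 * (p + 2))^3"
      proof -
        have "(p^3 * (p + 2) * (p + 4))^2 - (2 * p^2 * (p + 2))^3 = p^6 * (p + 2)^2 * ((p+4)^2 - 8 * (p + 2))"
          by (simp add: power_mult_distrib algebra_simps eval_nat_numeral)
        also have "(p+4)^2 - 8 * (p + 2) = p^2" by (simp add: power2_eq_square algebra_simps)
        also have "p^6 * (p + 2)^2 * p^2 > 0" using p by simp
        finally show ?thesis by linarith
      qed
      ultimately show ?thesis using p by (simp add: power_divide)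
    qed
    ultimately show False by simp
  qed
  with s_minus_R_power(1)[of 6] show ?thesis by simp
qed

text \<open>Equality would propagate down to s3 / s2 = s4 / s3 = R, whereas s2 s4 - s3^2 is strictly
  positive.\<close>

lemma R_lower: "s 6 / s 5 < R"
proof -
  let ?m = "\<lambda>k. R * s k - s (Suc k)"
  have "?m 5 \<noteq> 0"
  proof
    assume 5: "?m 5 = 0"
    have "?m 2 = 0" "?m 3 = 0"
      using log_convex_zero_down[of ?m 2 3] log_convex_zero_down[of ?m 3 2] R_times_s_minus_s(2) 5 by simp_all
    then have "R * s 2 = s 3" "s 4 = R * s 3" by simp_all
    then have "s 3 * s 3 = s 2 * s 4" by (metis mult.assoc mult.commute)
    moreover have "s 3 * s 3 \<noteq> s 2 * s 4"
    proof -
      define p where "p = \<alpha> + 1"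
      have p: "p > 0" using alpha_gt by (simp add: p_def)
      have e: "s 2 = 1 / (2 * p^2 * (p + 2))" "s 3 = 1 / (p^3 * (p + 2) * (p + 4))"
         "s 4 = (5 * p + 12) / (2 * p^4 * (p + 2)^2 * (p + 4) * (p + 6))"
        unfolding s_explicit p_def by (simp_all add: add.assoc)
      have "s 2 * s 4 - s 3 * s 3 = ((5 * p + 12) * (p + 4) - 4 * (p + 2) * (p + 6)) / (4 * p^6 * (p + 2)^3 * (p + 4)^2 * (p + 6))"
        unfolding e using p by (simp add: divide_simps eval_nat_numeral)
      also have "(5 * p + 12) * (p + 4) - 4 * (p + 2) * (p + 6) = p^2"
        by (simp add: power2_eq_square algebra_simps)
      also have "p^2 / (4 * p^6 * (p + 2)^3 * (p + 4)^2 * (p + 6)) > 0" using p by simp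
      finally show ?thesis by linarith
    qed
    ultimately show False by simp
  qed
  with R_times_s_minus_s(1)[of 5] have "s 6 < R * s 5" by simp
  then show ?thesis using s_pos[of 5] by (simp add: pos_divide_less_eq)
qed

subsection \<open>Laguerre polynomials and the Markov constant\<close>

text \<open>A linear functional on polynomials; the weighted inner product of p and q is
  \<open>J (p * q)\<close>.\<close>

definition J :: "real poly \<Rightarrow> real" where
  "J p = (LINT x:{0<..}|lborel. poly p x * laguerre_weight \<alpha> x)"

lemma has_bochner_integral_moment:
  "has_bochner_integral lborel (\<lambda>x. indicator {0<..} x *\<^sub>R (x ^ k * laguerre_weight \<alpha> x)) (Gamma (\<alpha> + 1 + real k))"
proof (rule has_bochner_integral_nn_integral)
  show "(\<lambda>x. indicator {0<..} x *\<^sub>R (x ^ k * laguerre_weight \<alpha> x)) \<in> borel_measurable lborel"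
    unfolding laguerre_weight_def by measurable
  show "0 \<le> Gamma (\<alpha> + 1 + real k)" using alpha_gt by (intro less_imp_le Gamma_real_pos) linarith
  show "AE x in lborel. 0 \<le> indicator {0<..} x *\<^sub>R (x ^ k * laguerre_weight \<alpha> x)"
    by (auto simp: laguerre_weight_def indicator_def)
  have "indicator {0<..} x *\<^sub>R (x ^ k * laguerre_weight \<alpha> x) = indicator {0..} x * x powr (\<alpha> + 1 + real k - 1) / exp x" for x :: real
    by (auto simp: indicator_def laguerre_weight_def powr_add powr_realpow exp_minus field_simps)
  then show "(\<integral>\<^sup>+ x. ennreal (indicator {0<..} x *\<^sub>R (x ^ k * laguerre_weight \<alpha> x)) \<partial>lborel) = ennreal (Gamma (\<alpha> + 1 + real k))"
    using Gamma_conv_nn_integral_real[of "\<alpha> + 1 + real k"] alpha_gt by simp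
qed

lemma set_integrable_poly_weight:
  "set_integrable lborel {0<..} (\<lambda>x. poly p x * laguerre_weight \<alpha> x)"
proof -
  have *: "set_integrable lborel {0<..} (\<lambda>x. coeff p i * (x ^ i * laguerre_weight \<alpha> x))" for i
    using has_bochner_integral_moment[of i] 
    by (intro set_integrable_mult_right) (auto simp: set_integrable_def has_bochner_integral_iff)
  have "set_integrable lborel {0<..} (\<lambda>x. \<Sum>i\<le>degree p. coeff p i * (x ^ i * laguerre_weight \<alpha> x))"
    using * unfolding set_integrable_def scaleR_sum_right by (intro Bochner_Integration.integrable_sum) auto
  then show ?thesis by (simp add: poly_altdef sum_distrib_right mult.assoc)
qed

lemma J_add: "J (p + q) = J p + J q"
  by (simp add: J_def distrib_right set_integral_add set_integrable_poly_weight)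

lemma J_smult: "J (smult a p) = a * J p"
  by (simp add: J_def mult.assoc)

lemma J_0 [simp]: "J 0 = 0"
  by (simp add: J_def)

lemma J_sum: "J (\<Sum>i\<in>S. f i) = (\<Sum>i\<in>S. J (f i))"
  by (induction S rule: infinite_finite_induct) (simp_all add: J_add)

lemma J_uminus: "J (- p) = - J p"
  using J_smult[of "-1" p] by simp

lemma J_diff: "J (p - q) = J p - J q"
  using J_add[of p "- q"] by (simp add: J_uminus)

lemma J_monom: "J (monom a k) = a * Gamma (\<alpha> + 1 + real k)"
proof -
  have "J (monom 1 k) = Gamma (\<alpha> + 1 + real k)"
    using has_bochner_integral_moment[of k]
    by (simp add: J_def poly_monom set_lebesgue_integral_def has_bochner_integral_iff)
  then show ?thesis using J_smult[of a "monom 1 k"] by (simp add: smult_monom)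
qed

text \<open>Integration by parts with (x w)' = (\<alpha> + 1 - x) w, checked on monomials, where it
  is the functional equation of Gamma.\<close>

lemma J_by_parts: "J ([:0, 1:] * pderiv p) = J ([:- (\<alpha> + 1), 1:] * p)"
proof -
  have m: "J ([:0, 1:] * pderiv (monom a k)) = J ([:- (\<alpha> + 1), 1:] * monom a k)" for a k
  proof -
    have 1: "[:0, 1:] * pderiv (monom a k) = monom (real k * a) k"
      unfolding pderiv_monom by (cases k) (simp_all add: monom_Suc)
    have 2: "[:- (\<alpha> + 1), 1:] * monom a k = monom a (Suc k) - smult (\<alpha> + 1) (monom a k)"
      by (simp add: monom_Suc smult_minus_left[symmetric] del: smult_minus_left)
    have "Gamma (\<alpha> + 1 + real (Suc k)) = (\<alpha> + 1 + real k) * Gamma (\<alpha> + 1 + real k)"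
      using Gamma_plus1[of "\<alpha> + 1 + real k"] alpha_gt by (simp add: add_ac nonpos_Ints_def)
    then show ?thesis unfolding 1 2 J_diff J_smult J_monom by (simp add: algebra_simps)
  qed
  have "J ([:0, 1:] * pderiv (\<Sum>i\<le>degree p. monom (coeff p i) i)) = J ([:- (\<alpha> + 1), 1:] * (\<Sum>i\<le>degree p. monom (coeff p i) i))"
    unfolding pderiv_sum sum_distrib_left J_sum m ..
  then show ?thesis by (simp only: poly_as_sum_of_monoms)
qed

lemma laguerre_norm_poly: "laguerre_norm \<alpha> (poly p) = sqrt (J (p * p))"
  by (simp add: laguerre_norm_def J_def power2_eq_square)

section \<open>Generalised Laguerre polynomials with parameter \<alpha>, from their three-term
  recurrence\<close>

fun lag :: "nat \<Rightarrow> real poly" where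
  "lag 0 = 1"
| "lag (Suc 0) = [:\<alpha> + 1, -1:]"
| "lag (Suc (Suc k)) = smult (1 / real (Suc (Suc k)))
     ([:2 * real k + 3 + \<alpha>, -1:] * lag (Suc k) - smult (real (Suc k) + \<alpha>) (lag k))"

lemma lag_rec:
  "smult (real (Suc (Suc k))) (lag (Suc (Suc k))) =
     [:2 * real k + 3 + \<alpha>, -1:] * lag (Suc k) - smult (real (Suc k) + \<alpha>) (lag k)"
  by simp

declare lag.simps(3) [simp del]

lemma lag_rec_poly:
  "real (Suc (Suc k)) * poly (lag (Suc (Suc k))) x =
     (2 * real k + 3 + \<alpha> - x) * poly (lag (Suc k)) x - (real (Suc k) + \<alpha>) * poly (lag k) x"
  using arg_cong[OF lag_rec, of "\<lambda>p. poly p x" k] by (simp add: algebra_simps)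

lemma lag_rec_pderiv:
  "real (Suc (Suc k)) * poly (pderiv (lag (Suc (Suc k)))) x =
     (2 * real k + 3 + \<alpha> - x) * poly (pderiv (lag (Suc k))) x - poly (lag (Suc k)) x
       - (real (Suc k) + \<alpha>) * poly (pderiv (lag k)) x"
  using arg_cong[OF lag_rec, of "\<lambda>p. poly (pderiv p) x" k]
  unfolding pderiv_smult pderiv_diff pderiv_mult by (simp add: pderiv_pCons algebra_simps)

text \<open>The two identities are proved together because the induction step for each uses
  both.\<close>

lemma lag_deriv_poly:
  "poly (pderiv (lag (Suc k))) x = poly (pderiv (lag k)) x - poly (lag k) x \<and>
   x * poly (pderiv (lag (Suc k))) x = real (Suc k) * poly (lag (Suc k)) x - (real (Suc k) + \<alpha>) * poly (lag k) x"
proof (induction k)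
  case 0
  then show ?case by (simp add: pderiv_pCons)
next
  case (Suc k)
  define l0 l1 l2 d0 d1 d2 where "l0 = poly (lag k) x" and "l1 = poly (lag (Suc k)) x"
    and "l2 = poly (lag (Suc (Suc k))) x" and "d0 = poly (pderiv (lag k)) x"
    and "d1 = poly (pderiv (lag (Suc k))) x" and "d2 = poly (pderiv (lag (Suc (Suc k)))) x"
  note defs = this
  have IH: "d1 = d0 - l0" "x * d1 = real (Suc k) * l1 - (real (Suc k) + \<alpha>) * l0"
    unfolding defs using Suc by blast+
  have r: "real (Suc (Suc k)) * l2 = (2 * real k + 3 + \<alpha> - x) * l1 - (real (Suc k) + \<alpha>) * l0"
    "real (Suc (Suc k)) * d2 = (2 * real k + 3 + \<alpha> - x) * d1 - l1 - (real (Suc k) + \<alpha>) * d0"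
    using lag_rec_poly lag_rec_pderiv by (simp_all only: defs)
  have d0: "d0 = d1 + l0" using IH(1) by simp
  have "real (Suc (Suc k)) * d2 = real (Suc (Suc k)) * (d1 - l1)"
    using r(2) IH(2) unfolding d0 by (simp add: algebra_simps)
  then have 1: "d2 = d1 - l1" by (simp del: of_nat_Suc)
  have "x * d2 = real (Suc (Suc k)) * l2 - (real (Suc (Suc k)) + \<alpha>) * l1"
    unfolding 1 r(1) using IH(2) by (simp add: algebra_simps)
  with 1 show ?case by (simp only: defs)
qed

lemma pderiv_lag_Suc: "pderiv (lag (Suc k)) = pderiv (lag k) - lag k"
  by (intro poly_eq_poly_eq_iff[THEN iffD1] ext) (simp add: lag_deriv_poly)

lemma X_times_pderiv_lag:
  "[:0, 1:] * pderiv (lag (Suc k)) = smult (real (Suc k)) (lag (Suc k)) - smult (real (Suc k) + \<alpha>) (lag k)"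
  by (intro poly_eq_poly_eq_iff[THEN iffD1] ext) (simp add: lag_deriv_poly[THEN conjunct2] del: of_nat_Suc)

lemma pderiv_lag: "pderiv (lag k) = - (\<Sum>j<k. lag j)"
  by (induction k) (simp_all add: pderiv_lag_Suc)

text \<open>Differentiate the second derivative identity and eliminate the lower polynomial by the
  first.\<close>

lemma lag_ode:
  "[:0, 1:] * pderiv (pderiv (lag k)) + [:\<alpha> + 1, -1:] * pderiv (lag k) = smult (- real k) (lag k)"
proof (cases k)
  case (Suc m)
  have "poly ([:0, 1:] * pderiv (pderiv (lag k)) + [:\<alpha> + 1, -1:] * pderiv (lag k)) x = poly (smult (- real k) (lag k)) x" for x
  proof -
    have "poly (pderiv ([:0, 1:] * pderiv (lag k))) x =
        real k * poly (pderiv (lag k)) x - (real k + \<alpha>) * poly (pderiv (lag m)) x"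
      unfolding Suc X_times_pderiv_lag by (simp add: pderiv_diff pderiv_smult)
    moreover have "poly (pderiv ([:0, 1:] * pderiv (lag k))) x =
        x * poly (pderiv (pderiv (lag k))) x + poly (pderiv (lag k)) x"
      unfolding pderiv_mult by (simp add: pderiv_pCons)
    moreover have "poly (pderiv (lag m)) x = poly (pderiv (lag k)) x + poly (lag m) x"
      unfolding Suc pderiv_lag_Suc by simp
    moreover have "x * poly (pderiv (lag k)) x = real k * poly (lag k) x - (real k + \<alpha>) * poly (lag m) x"
      using lag_deriv_poly[of m x] Suc by blast
    ultimately show ?thesis by (simp add: algebra_simps)
  qed
  then show ?thesis by (intro poly_eq_poly_eq_iff[THEN iffD1] ext)
qed simp

text \<open>Weak form of the Laguerre equation. Its right side is symmetric, which yields
  orthogonality for distinct k.\<close>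

lemma J_energy: "real k * J (lag k * q) = J ([:0, 1:] * (pderiv (lag k) * pderiv q))"
proof -
  let ?r = "pderiv (lag k) * q"
  have "smult (- real k) (lag k) * q = [:0, 1:] * pderiv ?r - [:- (\<alpha> + 1), 1:] * ?r
      - [:0, 1:] * (pderiv (lag k) * pderiv q)"
    unfolding lag_ode[symmetric]
    by (intro poly_eq_poly_eq_iff[THEN iffD1] ext) (simp add: pderiv_mult algebra_simps)
  then have "J (smult (- real k) (lag k) * q) = - J ([:0, 1:] * (pderiv (lag k) * pderiv q))"
    using J_by_parts[of ?r] by (simp only: J_diff)
  then show ?thesis by (simp add: J_smult J_uminus)
qed

lemma J_lag_orthogonal:
  assumes "j \<noteq> k"
  shows "J (lag j * lag k) = 0"
proof -
  have "real j * J (lag j * lag k) = real k * J (lag j * lag k)"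
    using J_energy[of j "lag k"] J_energy[of k "lag j"] by (simp add: mult.commute)
  with assms show ?thesis by simp
qed

text \<open>In \<open>J_energy\<close> with q = \<open>lag (Suc k)\<close>, expand one derivative by
  each derivative identity; orthogonality leaves only the square of \<open>lag k\<close>.\<close>

lemma J_lag_square: "J (lag k * lag k) = Gamma (\<alpha> + 1) * h k"
proof (induction k)
  case 0
  then show ?case using J_monom[of 1 0] by (simp add: monom_0 one_pCons)
next
  case (Suc k)
  have orth: "J (lag (Suc k) * lag j) = 0" if "j \<le> k" for j
    using that by (intro J_lag_orthogonal) auto
  have orth': "J (lag k * lag j) = 0" if "j < k" for j
    using that by (intro J_lag_orthogonal) auto
  have "real (Suc k) * J (lag (Suc k) * lag (Suc k)) =
      J (([:0, 1:] * pderiv (lag (Suc k))) * pderiv (lag (Suc k)))"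
    unfolding J_energy by (simp only: mult.assoc)
  also have "\<dots> = (real (Suc k) + \<alpha>) * (\<Sum>j<Suc k. J (lag k * lag j)) - real (Suc k) * (\<Sum>j<Suc k. J (lag (Suc k) * lag j))"
  proof -
    have JM: "J (q * (\<Sum>j<Suc k. lag j)) = (\<Sum>j<Suc k. J (q * lag j))" for q
      by (simp only: sum_distrib_left J_sum)
    have d: "(smult a p - smult b q) * - r = smult b (q * r) - smult a (p * r)" for a b :: real and p q r :: "real poly"
      by (simp add: algebra_simps)
    then show ?thesis
      unfolding X_times_pderiv_lag unfolding pderiv_lag[of "Suc k"] d by (simp only: J_diff J_smult JM)
  qed
  also have "\<dots> = (real (Suc k) + \<alpha>) * (Gamma (\<alpha> + 1) * h k)"
    using orth orth' Suc.IH by simp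
  also have "\<dots> = real (Suc k) * (Gamma (\<alpha> + 1) * h (Suc k))"
    using h_Suc[of k] by (simp add: algebra_simps)
  finally show ?case by simp
qed

section \<open>Expansions in the Laguerre basis and the exact Markov constant\<close>

lemma J_lag_expansion:
  fixes a :: "nat \<Rightarrow> real"
  assumes "finite S"
  shows "J ((\<Sum>k\<in>S. smult (a k) (lag k)) * (\<Sum>k\<in>S. smult (a k) (lag k))) = Gamma (\<alpha> + 1) * (\<Sum>k\<in>S. h k * (a k)\<^sup>2)"
proof -
  have "J ((\<Sum>k\<in>S. smult (a k) (lag k)) * (\<Sum>k\<in>S. smult (a k) (lag k)))
      = (\<Sum>k\<in>S. \<Sum>j\<in>S. a k * (a j * J (lag k * lag j)))"
    by (simp add: sum_product J_sum J_smult mult_ac)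
  also have "\<dots> = (\<Sum>k\<in>S. \<Sum>j\<in>S. if j = k then a k * (a k * J (lag k * lag k)) else 0)"
    by (intro sum.cong refl) (auto simp: J_lag_orthogonal)
  also have "\<dots> = Gamma (\<alpha> + 1) * (\<Sum>k\<in>S. h k * (a k)\<^sup>2)"
    using assms by (simp add: J_lag_square sum_distrib_left power2_eq_square mult_ac)
  finally show ?thesis .
qed

lemma degree_lag: "degree (lag k) \<le> k \<and> coeff (lag k) k \<noteq> 0"
proof (induction k rule: less_induct)
  case (less k)
  show ?case
  proof (cases k rule: lag.cases)
    case (3 m)
    have IH: "degree (lag m) \<le> m" "degree (lag (Suc m)) \<le> Suc m" "coeff (lag (Suc m)) (Suc m) \<noteq> 0"
      using less 3 by auto
    have "coeff (lag k) i = (1 / real k) * ((2 * real m + 3 + \<alpha>) * coeff (lag (Suc m)) i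
        - (case i of 0 \<Rightarrow> 0 | Suc j \<Rightarrow> coeff (lag (Suc m)) j) - (real (Suc m) + \<alpha>) * coeff (lag m) i)" for i
      unfolding 3 by (simp add: lag.simps(3) coeff_pCons split: nat.splits) 
    note cf = this
    have "coeff (lag k) i = 0" if "i > k" for i
      unfolding cf using that 3 IH by (auto simp: coeff_eq_0 split: nat.splits)
    moreover have "coeff (lag k) k \<noteq> 0"
      unfolding cf using 3 IH by (auto simp: coeff_eq_0)
    ultimately show ?thesis by (simp add: degree_le)
  qed simp_all
qed

lemma lag_spans:
  assumes "degree p \<le> n"
  shows "\<exists>a. p = (\<Sum>k\<le>n. smult (a k) (lag k))"
  using assms
proof (induction n arbitrary: p)
  case 0
  then obtain x where "p = [:x:]" by (metis degree_eq_zeroE le_zero_eq)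
  then show ?case by (intro exI[of _ "\<lambda>_. x"]) simp
next
  case (Suc n)
  define b where "b = coeff p (Suc n) / coeff (lag (Suc n)) (Suc n)"
  define q where "q = p - smult b (lag (Suc n))"
  have "coeff q i = 0" if "i > n" for i
  proof (cases "i = Suc n")
    case True
    then show ?thesis using degree_lag[of "Suc n"] by (simp add: q_def b_def)
  next
    case False
    then have "i > Suc n" using that by simp
    then show ?thesis using degree_lag[of "Suc n"] Suc.prems by (simp add: q_def coeff_eq_0)
  qed
  then have "degree q \<le> n" by (intro degree_le) auto
  from Suc.IH[OF this] obtain a where a: "q = (\<Sum>k\<le>n. smult (a k) (lag k))" by blast
  have "p = (\<Sum>k\<le>n. smult (a k) (lag k)) + smult b (lag (Suc n))"
    unfolding a[symmetric] by (simp add: q_def)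
  also have "\<dots> = (\<Sum>k\<le>Suc n. smult ((a(Suc n := b)) k) (lag k))" by simp
  finally show ?case by blast
qed

text \<open>Differentiation replaces coefficients by negated tail sums. As differences of tails
  recover the coefficients, the Markov quotient becomes a discrete Hardy quotient.\<close>

lemma pderiv_lag_expansion:
  fixes a :: "nat \<Rightarrow> real"
  shows "pderiv (\<Sum>k\<le>n. smult (a k) (lag k)) = (\<Sum>j<n. smult (- (\<Sum>k\<in>{j<..n}. a k)) (lag j))"
proof (induction n)
  case 0
  then show ?case by (simp add: pderiv_smult)
next
  case (Suc n)
  have s: "(\<Sum>k\<in>{j<..Suc n}. a k) = (\<Sum>k\<in>{j<..n}. a k) + a (Suc n)" if "j \<le> n" for j
  proof -
    have "{j<..Suc n} = insert (Suc n) {j<..n}" using that by auto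
    then show ?thesis by simp
  qed
  have "pderiv (\<Sum>k\<le>Suc n. smult (a k) (lag k)) =
      (\<Sum>j<Suc n. smult (- (\<Sum>k\<in>{j<..n}. a k)) (lag j)) + (\<Sum>j<Suc n. smult (- a (Suc n)) (lag j))"
    using Suc by (simp add: pderiv_add pderiv_smult pderiv_lag[of "Suc n"] smult_sum_right sum_negf smult_add_right smult_diff_right)
  also have "\<dots> = (\<Sum>j<Suc n. smult (- (\<Sum>k\<in>{j<..Suc n}. a k)) (lag j))"
    unfolding sum.distrib[symmetric] by (intro sum.cong refl) (simp add: s smult_add_left[symmetric] del: smult_minus_left)
  finally show ?case .
qed

lemma Gamma_pos: "Gamma (\<alpha> + 1) > 0"
  using alpha_gt by (intro Gamma_real_pos) simp

text \<open>\<open>hardy\<close> applied to the tail sums gives the upper bound; tail sums equal to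
  \<open>u k (rho n)\<close> attain it, so the supremum is a maximum.\<close>

lemma markov_constant_eq:
  assumes "n > 0"
  shows "markov_constant \<alpha> n = sqrt (1 / rho n)"
proof -
  note rho = rho[OF assms]
  have upper: "laguerre_norm \<alpha> (poly (pderiv p)) / laguerre_norm \<alpha> (poly p) \<le> sqrt (1 / rho n)"
    if "degree p \<le> n" "p \<noteq> 0" for p
  proof -
    from lag_spans[OF that(1)] obtain a where p: "p = (\<Sum>k\<le>n. smult (a k) (lag k))" by blast
    define b where "b j = (\<Sum>k\<in>{j<..n}. a k)" for j
    have b: "b k - b (Suc k) = a (Suc k)" if "k < n" for k
    proof -
      have "{k<..n} = insert (Suc k) {Suc k<..n}" using that by auto
      then show ?thesis by (simp add: b_def)
    qed
    have Jp: "J (p * p) = Gamma (\<alpha> + 1) * (\<Sum>k\<le>n. h k * (a k)\<^sup>2)"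
      unfolding p by (rule J_lag_expansion) simp
    have Jd: "J (pderiv p * pderiv p) = Gamma (\<alpha> + 1) * (\<Sum>k<n. h k * (b k)\<^sup>2)"
      unfolding p pderiv_lag_expansion by (subst J_lag_expansion) (simp_all add: b_def)
    have "(\<Sum>k\<le>n. h k * (a k)\<^sup>2) > 0"
    proof -
      have "\<exists>k\<le>n. a k \<noteq> 0" using that(2) unfolding p by (metis (no_types, lifting) atMost_iff smult_0_left sum.neutral)
      then obtain k where "k \<le> n" "a k \<noteq> 0" by blast
      then show ?thesis by (intro sum_pos2[of _ k]) (auto intro!: mult_pos_pos h_pos mult_nonneg_nonneg less_imp_le[OF h_pos])
    qed
    then have pos: "J (p * p) > 0" unfolding Jp using Gamma_pos by simp
    have "rho n * (\<Sum>k<n. h k * (b k)\<^sup>2) \<le> (\<Sum>k<n. h (Suc k) * (b k - b (Suc k))\<^sup>2)"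
      using rho by (intro hardy) (auto simp: b_def)
    also have "\<dots> = (\<Sum>k<n. h (Suc k) * (a (Suc k))\<^sup>2)" by (intro sum.cong) (auto simp: b)
    also have "\<dots> \<le> h 0 * (a 0)\<^sup>2 + (\<Sum>k<n. h (Suc k) * (a (Suc k))\<^sup>2)" by simp
    also have "\<dots> = (\<Sum>k\<le>n. h k * (a k)\<^sup>2)"
      using sum.lessThan_Suc_shift[of "\<lambda>k. h k * (a k)\<^sup>2" n] by (simp only: lessThan_Suc_atMost)
    finally have "rho n * J (pderiv p * pderiv p) \<le> J (p * p)"
      unfolding Jp Jd using Gamma_pos by (simp add: mult.left_commute)
    then have "J (pderiv p * pderiv p) / J (p * p) \<le> 1 / rho n"
      using rho(1) pos by (simp add: field_simps)
    then show ?thesis unfolding laguerre_norm_poly real_sqrt_divide[symmetric] by simp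
  qed
  \<comment> \<open>The extremal polynomial: coefficients are chosen so that the tail sums are b,
    which is possible because b n = 0; setting a 0 = 0 leaves no norm outside the Hardy sum.\<close>
  define b :: "nat \<Rightarrow> real" where "b k = u k (rho n)" for k
  define a where "a k = (case k of 0 \<Rightarrow> 0 | Suc j \<Rightarrow> b j - b (Suc j))" for k
  define p where "p = (\<Sum>k\<le>n. smult (a k) (lag k))"
  have bn: "b n = 0" using rho by (simp add: b_def)
  have ba: "(\<Sum>k\<in>{j<..n}. a k) = b j" if "j \<le> n" for j
  proof -
    have "(\<Sum>k\<in>{j<..n}. a k) = (\<Sum>k\<in>{j..<n}. b k - b (Suc k))"
      by (rule sum.reindex_bij_witness[of _ Suc "\<lambda>k. k - 1"]) (auto simp: a_def split: nat.splits)
    also have "\<dots> = b j - b n" using that by (rule sum_Suc_diff'[of j n "\<lambda>k. - b k", simplified])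
    finally show ?thesis using bn by simp
  qed
  have N: "(\<Sum>k<n. h k * (b k)\<^sup>2) > 0"
    using assms by (intro sum_pos2[of _ 0]) (auto simp: b_def intro!: mult_nonneg_nonneg less_imp_le[OF h_pos])
  have Jp: "J (p * p) = Gamma (\<alpha> + 1) * (\<Sum>k\<le>n. h k * (a k)\<^sup>2)"
    unfolding p_def by (rule J_lag_expansion) simp
  also have "(\<Sum>k\<le>n. h k * (a k)\<^sup>2) = (\<Sum>k<n. h (Suc k) * (b k - b (Suc k))\<^sup>2)"
    unfolding lessThan_Suc_atMost[symmetric] sum.lessThan_Suc_shift by (simp add: a_def)
  also have "\<dots> = rho n * (\<Sum>k<n. h k * (b k)\<^sup>2)"
    using u_energy[of "rho n" b n] bn by (simp add: b_def power2_eq_square mult.assoc)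
  finally have Jp': "J (p * p) = rho n * (Gamma (\<alpha> + 1) * (\<Sum>k<n. h k * (b k)\<^sup>2))" by simp
  have "pderiv p = (\<Sum>j<n. smult (- b j) (lag j))"
    unfolding p_def pderiv_lag_expansion by (intro sum.cong refl) (simp add: ba)
  then have Jd: "J (pderiv p * pderiv p) = Gamma (\<alpha> + 1) * (\<Sum>k<n. h k * (b k)\<^sup>2)"
    by (simp only: J_lag_expansion[OF finite_lessThan] power2_minus)
  have "J (p * p) > 0" unfolding Jp' using N Gamma_pos rho(1) by simp
  then have "p \<noteq> 0" by auto
  have "J (pderiv p * pderiv p) / J (p * p) = 1 / rho n"
    unfolding Jd Jp' using N Gamma_pos by simp
  then have attained: "laguerre_norm \<alpha> (poly (pderiv p)) / laguerre_norm \<alpha> (poly p) = sqrt (1 / rho n)"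
    unfolding laguerre_norm_poly real_sqrt_divide[symmetric] by simp
  have "degree p \<le> n" unfolding p_def
    by (intro degree_sum_le) (auto intro: order.trans[OF degree_smult_le] order.trans[OF conjunct1[OF degree_lag]])
  with \<open>p \<noteq> 0\<close> attained upper show ?thesis
    unfolding markov_constant_def by (intro cSup_eq_maximum) (auto intro!: image_eqI[of _ _ p])
qed

lemma markov_constant_tendsto: "(\<lambda>n. markov_constant \<alpha> n / real n) \<longlonglongrightarrow> sqrt R"
proof -
  have "(\<lambda>n. sqrt (top_eig n)) \<longlonglongrightarrow> sqrt R"
    by (intro tendsto_intros top_eig_tendsto)
  moreover have "eventually (\<lambda>n. sqrt (top_eig n) = markov_constant \<alpha> n / real n) sequentially"
    using eventually_gt_at_top[of 0]
    by eventually_elim (simp only: markov_constant_eq top_eig_def real_sqrt_divide real_sqrt_abs abs_of_nat)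
  ultimately show ?thesis by (rule Lim_transform_eventually)
qed

subsection \<open>The bound for large parameters\<close>

text \<open>Up to normalisation, \<open>phi (x\<^sup>2)\<close> is \<open>x powr (-\<nu>)\<close> times the Bessel function of order \<open>\<nu> = (\<alpha> - 1) / 2\<close>.\<close>

definition phi :: "real \<Rightarrow> real" where
  "phi z = (\<Sum>m. c m * z ^ m)"

definition phi' :: "real \<Rightarrow> real" where
  "phi' z = (\<Sum>m. diffs c m * z ^ m)"

definition phi'' :: "real \<Rightarrow> real" where
  "phi'' z = (\<Sum>m. diffs (diffs c) m * z ^ m)"

lemma c_bound: "\<bar>c m\<bar> \<le> (1 / (2 * (\<alpha> + 1))) ^ m / fact m"
proof (induction m)
  case (Suc m)
  have a: "\<alpha> + 1 > 0" using alpha_gt by simp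
  have "\<bar>c (Suc m)\<bar> * (2 * (\<alpha> + 1) * real (Suc m)) \<le> \<bar>c (Suc m)\<bar> * (2 * real (Suc m) * (\<alpha> + 2 * real m + 1))"
    using a by (intro mult_left_mono) (auto simp: algebra_simps)
  also have "\<dots> = \<bar>2 * real (Suc m) * (\<alpha> + 2 * real m + 1) * c (Suc m)\<bar>"
    using a by (simp add: abs_mult mult_ac)
  also have "\<dots> = \<bar>c m\<bar>" unfolding c_Suc by simp
  finally have "\<bar>c (Suc m)\<bar> \<le> \<bar>c m\<bar> / (2 * (\<alpha> + 1) * real (Suc m))"
    using a by (simp add: pos_le_divide_eq)
  also have "\<dots> \<le> ((1 / (2 * (\<alpha> + 1))) ^ m / fact m) / (2 * (\<alpha> + 1) * real (Suc m))"
    using a Suc by (intro divide_right_mono) auto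
  also have "\<dots> = (1 / (2 * (\<alpha> + 1))) ^ Suc m / fact (Suc m)"
    using a by (simp add: field_simps)
  finally show ?case .
qed simp

lemma summable_c: "summable (\<lambda>m. c m * z ^ m)"
proof (rule summable_comparison_test)
  let ?K = "\<bar>z\<bar> / (2 * (\<alpha> + 1))"
  show "summable (\<lambda>m. inverse (fact m) * ?K ^ m)" by (rule summable_exp)
  have "norm (c m * z ^ m) \<le> inverse (fact m) * ?K ^ m" for m
    using mult_right_mono[OF c_bound[of m], of "\<bar>z\<bar> ^ m"]
    by (simp add: abs_mult power_abs power_divide field_simps)
  then show "\<exists>N. \<forall>m\<ge>N. norm (c m * z ^ m) \<le> inverse (fact m) * ?K ^ m" by blast
qed

lemma summable_diffs_c: "summable (\<lambda>m. diffs c m * z ^ m)"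
  by (rule termdiff_converges_all) (rule summable_c)

lemma phi_deriv: "(phi has_field_derivative phi' z) (at z)"
  unfolding phi_def[abs_def] phi'_def by (rule termdiffs_strong_converges_everywhere) (rule summable_c)

lemma phi'_deriv: "(phi' has_field_derivative phi'' z) (at z)"
  unfolding phi'_def[abs_def] phi''_def by (rule termdiffs_strong_converges_everywhere) (rule summable_diffs_c)

lemma phi_0 [simp]: "phi 0 = 1"
  by (simp add: phi_def)

text \<open>Bessel's equation in the variable z = x^2; coefficientwise it is
  \<open>c_Suc\<close>.\<close>

lemma phi_ode: "4 * z * phi'' z + 2 * (\<alpha> + 1) * phi' z + phi z = 0"
proof -
  have "(\<lambda>m. diffs (diffs c) m * z ^ m) sums phi'' z"
    unfolding phi''_def by (intro summable_sums termdiff_converges_all summable_diffs_c)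
  then have "(\<lambda>m. z * (diffs (diffs c) m * z ^ m)) sums (z * phi'' z)"
    by (rule sums_mult)
  also have "(\<lambda>m. z * (diffs (diffs c) m * z ^ m)) = (\<lambda>m. real (Suc m) * diffs c (Suc m) * z ^ Suc m)"
    by (simp add: diffs_def mult_ac fun_eq_iff)
  finally have "(\<lambda>m. real m * diffs c m * z ^ m) sums (z * phi'' z)"
    by (subst (asm) sums_Suc_iff) simp
  moreover have "(\<lambda>m. diffs c m * z ^ m) sums phi' z"
    unfolding phi'_def by (intro summable_sums summable_diffs_c)
  moreover have "(\<lambda>m. c m * z ^ m) sums phi z"
    unfolding phi_def by (intro summable_sums summable_c)
  ultimately have "(\<lambda>m. 4 * (real m * diffs c m * z ^ m) + 2 * (\<alpha> + 1) * (diffs c m * z ^ m) + c m * z ^ m)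
      sums (4 * (z * phi'' z) + 2 * (\<alpha> + 1) * phi' z + phi z)"
    by (intro sums_add sums_mult)
  moreover have "4 * (real m * diffs c m * z ^ m) + 2 * (\<alpha> + 1) * (diffs c m * z ^ m) + c m * z ^ m = 0" for m
  proof -
    have "4 * (real m * diffs c m * z ^ m) + 2 * (\<alpha> + 1) * (diffs c m * z ^ m) + c m * z ^ m =
      (2 * real (Suc m) * (\<alpha> + 2 * real m + 1) * c (Suc m) + c m) * z ^ m"
      by (simp add: diffs_def algebra_simps)
    then show ?thesis unfolding c_Suc by simp
  qed
  ultimately show ?thesis using sums_unique2[of "\<lambda>_. 0::real"] by (simp add: mult.assoc)
qed

text \<open>Tannery's theorem applied to u n (rho n) = 0, whose m-th term tends to the m-th term of
  phi at 1 / R.\<close>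

lemma phi_inverse_R: "phi (1 / R) = 0"
proof -
  define Z where "Z = 1 / R + 1"
  \<comment> \<open>The majorant combines \<open>A_le\<close>, 1 + 1/n \<le> 2 and the eventual
    bound 1 / top_eig n < Z.\<close>
  define M where "M m = inverse (fact m) * (Z / (\<alpha> + 1)) ^ m" for m
  define f where "f m n = (-1) ^ m * A m n / real n ^ (2 * m) * (1 / top_eig n) ^ m" for m n
  have lim_inv: "(\<lambda>n. 1 / top_eig n) \<longlonglongrightarrow> 1 / R"
    using R_pos by (intro tendsto_intros top_eig_tendsto) auto
  have "eventually (\<lambda>n. 1 / top_eig n < Z) sequentially"
    by (rule order_tendstoD(2)[OF lim_inv]) (simp add: Z_def)
  then have "eventually (\<lambda>n. \<forall>m. norm (f m n) \<le> M m) sequentially"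
    using eventually_gt_at_top[of 0]
  proof eventually_elim
    case (elim n)
    show ?case
    proof
      fix m
      have a: "\<alpha> + 1 > 0" using alpha_gt by simp
      have "A m n / real n ^ (2 * m) \<le> (real n * real (Suc n) / (2 * (\<alpha> + 1))) ^ m / fact m / real n ^ (2 * m)"
        by (intro divide_right_mono A_le) simp
      also have "\<dots> = ((1 + 1 / real n) / 2 / (\<alpha> + 1)) ^ m / fact m"
      proof -
        have "E ^ m / fact m / real n ^ (2 * m) = (E / (real n)\<^sup>2) ^ m / fact m" for E :: real
          by (simp add: power_divide power_mult)
        moreover have "real n * real (Suc n) / (2 * (\<alpha> + 1)) / (real n)\<^sup>2 = (1 + 1 / real n) / 2 / (\<alpha> + 1)"
          using elim a by (simp add: divide_simps power2_eq_square)
        ultimately show ?thesis by simp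
      qed
      also have "\<dots> \<le> (1 / (\<alpha> + 1)) ^ m / fact m"
      proof (rule divide_right_mono[OF power_mono])
        show "(1 + 1 / real n) / 2 / (\<alpha> + 1) \<le> 1 / (\<alpha> + 1)" using elim a by (intro divide_right_mono) (auto simp: field_simps)
        show "0 \<le> (1 + 1 / real n) / 2 / (\<alpha> + 1)" using a by (intro divide_nonneg_nonneg) auto
      qed simp
      finally have 1: "A m n / real n ^ (2 * m) \<le> (1 / (\<alpha> + 1)) ^ m / fact m" .
      have 2: "(1 / top_eig n) ^ m \<le> Z ^ m"
        using elim top_eig_pos[of n] by (intro power_mono) auto
      have "norm (f m n) = A m n / real n ^ (2 * m) * (1 / top_eig n) ^ m"
        using A_nonneg[of m n] top_eig_pos[of n] elim by (simp add: f_def abs_mult power_abs)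
      also have "\<dots> \<le> (1 / (\<alpha> + 1)) ^ m / fact m * Z ^ m"
        using 1 2 a A_nonneg[of m n] top_eig_pos[of n] elim by (intro mult_mono) auto
      also have "\<dots> = M m" by (simp add: M_def power_divide field_simps)
      finally show "norm (f m n) \<le> M m" .
    qed
  qed
  then have "eventually (\<lambda>(m, n). norm (f m n) \<le> M m) (at_top \<times>\<^sub>F sequentially)"
    by (subst (asm) eventually_prod2[of at_top, symmetric]) (auto elim: eventually_mono)
  moreover have "(\<lambda>n. f m n) \<longlonglongrightarrow> c m * (1 / R) ^ m" for m
    unfolding f_def by (intro tendsto_intros A_tendsto lim_inv)
  moreover have "summable M" unfolding M_def by (rule summable_exp)
  ultimately have lim: "(\<lambda>n. \<Sum>m. f m n) \<longlonglongrightarrow> (\<Sum>m. c m * (1 / R) ^ m)"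
    using tannerys_theorem[of f "\<lambda>m. c m * (1 / R) ^ m" sequentially M] by simp
  have "eventually (\<lambda>n. (\<Sum>m. f m n) = 0) sequentially"
    using eventually_gt_at_top[of 0]
  proof eventually_elim
    case (elim n)
    have "(\<Sum>m. f m n) = (\<Sum>m\<le>n. f m n)"
      by (rule suminf_finite) (auto simp: f_def A_eq_0)
    also have "\<dots> = u n (rho n)"
      unfolding u_def f_def top_eig_def using elim rho(1)[OF elim]
      by (intro sum.cong refl) (simp add: power_mult power_divide power_minus[of "rho n"] power_mult_distrib)
    finally show ?case using rho(2)[OF elim] by simp
  qed
  from LIMSEQ_unique[OF lim tendsto_eventually[OF this]] show ?thesis
    by (simp add: phi_def)
qed

text \<open>Passing from the root 1 / R to the least root z \<le> 1 / R provides the positivity that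
  the Sturm comparison requires, while an upper bound on 1 / R still bounds z.\<close>

lemma phi_least_root:
  assumes "b > 0" "phi b = 0"
  obtains z where "0 < z" "z \<le> b" "phi z = 0" "\<And>x. 0 \<le> x \<Longrightarrow> x < z \<Longrightarrow> phi x > 0"
proof -
  have cont: "continuous_on S phi" for S
    by (intro continuous_at_imp_continuous_on ballI DERIV_isCont[OF phi_deriv])
  define Z where "Z = {x\<in>{0..b}. phi x = 0}"
  have "closed Z" unfolding Z_def
    by (intro continuous_closed_preimage_constant cont closed_atLeastAtMost)
  moreover have "bounded Z" by (rule bounded_subset[OF bounded_closed_interval[of 0 b]]) (auto simp: Z_def)
  ultimately have "compact Z" by (simp add: compact_eq_bounded_closed)
  moreover have "Z \<noteq> {}" using assms by (auto simp: Z_def)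
  ultimately obtain z where z: "z \<in> Z" "\<And>x. x \<in> Z \<Longrightarrow> z \<le> x"
    using compact_attains_inf by meson
  have "phi x > 0" if "0 \<le> x" "x < z" for x
  proof (rule ccontr)
    assume "\<not> ?thesis"
    then have "\<exists>y. 0 \<le> y \<and> y \<le> x \<and> phi y = 0"
      using that by (intro IVT2') (auto intro: cont)
    then obtain y where "0 \<le> y" "y \<le> x" "phi y = 0" by blast
    with that z(1) have "y \<in> Z" by (auto simp: Z_def)
    from z(2)[OF this] \<open>y \<le> x\<close> that show False by simp
  qed
  moreover have "z \<noteq> 0" using z(1) by (auto simp: Z_def)
  ultimately show ?thesis using z(1) that[of z] by (auto simp: Z_def)
qed

lemma R_less_large_alpha:
  assumes "\<alpha> \<ge> 171"
  shows "R < 4 / (\<alpha>\<^sup>2 + 10 * \<alpha> + 8)"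
proof (rule ccontr)
  assume "\<not> ?thesis"
  define \<nu> where "\<nu> = (\<alpha> - 1) / 2"
  have \<nu>: "\<nu> \<ge> 85" "\<alpha> = 2 * \<nu> + 1" using assms by (auto simp: \<nu>_def field_simps)
  have q: "\<alpha>\<^sup>2 + 10 * \<alpha> + 8 > 0" using assms by (simp add: add_nonneg_pos)
  have "1 / R \<le> (\<alpha>\<^sup>2 + 10 * \<alpha> + 8) / 4"
    using \<open>\<not> _\<close> R_pos q by (simp add: field_simps)
  also have "\<dots> = \<nu>\<^sup>2 + 6 * \<nu> + 19/4" unfolding \<nu>(2) by (simp add: power2_eq_square field_simps)
  finally have R: "1 / R \<le> \<nu>\<^sup>2 + 6 * \<nu> + 19/4" .
  obtain z where z: "0 < z" "z \<le> 1 / R" "phi z = 0" "\<And>x. 0 \<le> x \<Longrightarrow> x < z \<Longrightarrow> phi x > 0"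
    using phi_least_root[of "1 / R"] phi_inverse_R R_pos by auto
  txt \<open>The Wronskian \<open>x powr \<alpha> * (w' x * F x - w x * F' x)\<close> of \<open>w x = phi (z * x\<^sup>2)\<close> and
    \<open>F x = x powr (-\<nu>) - 1\<close>; it vanishes at \<open>0\<close> and \<open>1\<close>, but its derivative is positive in between.\<close>
  define W where "W x = 2 * z * phi' (z * x\<^sup>2) * x\<^sup>2 * (x powr \<nu> - (x powr \<nu>)\<^sup>2) + \<nu> * x powr \<nu> * phi (z * x\<^sup>2)" for x
  have deriv: "\<exists>y. (W has_real_derivative y) (at x) \<and> y > 0" if x: "0 < x" "x < 1" for x
  proof -
    define X where "X = x powr \<nu>"
    have X: "X > 0" using x by (simp add: X_def)
    have dX: "((\<lambda>x. x powr \<nu>) has_real_derivative \<nu> * X / x) (at x)"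
      using x by (auto intro!: derivative_eq_intros simp: X_def powr_diff)
    have dphi: "((\<lambda>x. phi (z * x\<^sup>2)) has_real_derivative phi' (z * x\<^sup>2) * (z * (2 * x))) (at x)"
      by (rule DERIV_chain2[OF phi_deriv]) (auto intro!: derivative_eq_intros)
    have dphi': "((\<lambda>x. phi' (z * x\<^sup>2)) has_real_derivative phi'' (z * x\<^sup>2) * (z * (2 * x))) (at x)"
      by (rule DERIV_chain2[OF phi'_deriv]) (auto intro!: derivative_eq_intros)
    define p0 p1 p2 where "p0 = phi (z * x\<^sup>2)" and "p1 = phi' (z * x\<^sup>2)" and "p2 = phi'' (z * x\<^sup>2)"
    have "2 * (\<alpha> + 1) = 4 * (\<nu> + 1)" using \<nu>(2) by simp
    note phi_ode[of "z * x\<^sup>2", unfolded this]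
    then have ode: "4 * (z * x\<^sup>2) * p2 = - 4 * (\<nu> + 1) * p1 - p0"
      unfolding p0_def p1_def p2_def by (simp add: algebra_simps)
    define D where "D = 2 * z * (p2 * (z * (2 * x))) * x\<^sup>2 * (X - X\<^sup>2) + 2 * z * p1 * (2 * x) * (X - X\<^sup>2)
        + 2 * z * p1 * x\<^sup>2 * (\<nu> * X / x - 2 * X * (\<nu> * X / x)) + \<nu> * (\<nu> * X / x) * p0 + \<nu> * X * (p1 * (z * (2 * x)))"
    have "(W has_real_derivative D) (at x)"
    proof -
      have dsq: "((\<lambda>x. x\<^sup>2) has_real_derivative 2 * x) (at x)"
        by (auto intro!: derivative_eq_intros)
      have dX2: "((\<lambda>x. (x powr \<nu>)\<^sup>2) has_real_derivative 2 * X * (\<nu> * X / x)) (at x)"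
        using DERIV_power[OF dX, of 2] by (simp add: X_def mult_ac)
      show ?thesis
        unfolding W_def[abs_def]
        by (rule DERIV_cong[OF DERIV_add[OF DERIV_mult[OF DERIV_mult[OF DERIV_cmult[OF dphi'] dsq]
              DERIV_diff[OF dX dX2]] DERIV_mult[OF DERIV_cmult[OF dX] dphi]]])
           (simp add: D_def X_def[symmetric] p0_def p1_def p2_def algebra_simps)
    qed
    moreover have "D > 0"
    proof -
      \<comment> \<open>Multiplying by x clears the fractions; after the differential equation
        eliminates p2, all terms in p1 cancel.\<close>
      have "x * D = z * x\<^sup>2 * (4 * (z * x\<^sup>2) * p2) * (X - X\<^sup>2) + 4 * z * p1 * x\<^sup>2 * (X - X\<^sup>2)
        + 2 * z * p1 * x\<^sup>2 * (\<nu> * X - 2 * X * (\<nu> * X)) + \<nu>\<^sup>2 * X * p0 + 2 * \<nu> * X * p1 * z * x\<^sup>2"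
        using x unfolding D_def by (simp add: power2_eq_square field_simps)
      also have "\<dots> = X * p0 * (\<nu>\<^sup>2 - z * x\<^sup>2 * (1 - X))"
        unfolding ode by (simp add: power2_eq_square algebra_simps)
      also have "\<dots> > 0"
      proof (intro mult_pos_pos X)
        have "z * x\<^sup>2 < z" using x z(1) by (simp add: power_less_one_iff abs_square_less_1)
        then show "p0 > 0" unfolding p0_def using z(1) by (intro z(4)) auto
        show "0 < \<nu>\<^sup>2 - z * x\<^sup>2 * (1 - X)"
          using x_squared_bound[OF \<nu>(1) x, of z] z(2) R by (simp add: X_def)
      qed
      finally show ?thesis using x by (simp add: zero_less_mult_iff)
    qed
    ultimately show ?thesis by blast
  qed
  have c1: "continuous_on {0..1} (\<lambda>x. phi (z * x\<^sup>2))" "continuous_on {0..1} (\<lambda>x. phi' (z * x\<^sup>2))"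
    by (auto intro!: continuous_at_imp_continuous_on continuous_intros isCont_o2[OF _ DERIV_isCont[OF phi_deriv]] isCont_o2[OF _ DERIV_isCont[OF phi'_deriv]])
  have contW: "continuous_on {0..1} W"
    unfolding W_def using \<nu>(1) by (intro continuous_intros c1 continuous_on_powr') auto
  have "W 0 < W 1"
    by (rule DERIV_pos_imp_increasing_open[OF zero_less_one deriv contW])
  then show False by (simp add: W_def z(3))
qed

end

subsection \<open>The crossing point of the two upper bounds\<close>

text \<open>For positive coefficients and degree below n, q(x) / x^n is strictly decreasing;
  cross-multiplied, this is Descartes' rule for one sign change.\<close>

lemma sum_powers_scaled_less:
  fixes a :: "nat \<Rightarrow> real"
  assumes "0 < x" "x < y" "0 < n" "\<And>i. i < n \<Longrightarrow> a i > 0"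
  shows "(\<Sum>i<n. a i * y ^ i) * x ^ n < (\<Sum>i<n. a i * x ^ i) * y ^ n"
  unfolding sum_distrib_right
proof (rule sum_strict_mono)
  fix i assume i: "i \<in> {..<n}"
  have "(x * y) ^ i * x ^ (n - i) < (x * y) ^ i * y ^ (n - i)"
    using assms i by (intro mult_strict_left_mono power_strict_mono) auto
  moreover have "z ^ n = z ^ i * z ^ (n - i)" for z :: real
    using i by (simp flip: power_add)
  ultimately have "y ^ i * x ^ n < x ^ i * y ^ n"
    by (metis mult.assoc mult.commute power_mult_distrib)
  then show "a i * y ^ i * x ^ n < a i * x ^ i * y ^ n"
    using assms(4)[of i] i by (simp add: mult.assoc)
qed (use assms in auto)

text \<open>In \<open>crossing_poly\<close> below only the leading coefficient is positive, so that it has a single positive root; these are the other coefficients with their signs reversed.\<close>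

definition crossing_coeffs :: "real list" where
  "crossing_coeffs = [1372581888, 10398908416, 35323457536, 71190233088, 94921982976, 88338003456, 58924511424, 28448573056, 9921473872, 2472600624, 431639940, 51006336, 3834975, 161153, 2537]"

text \<open>The equation of the two upper bounds raised to the sixth power and cleared of
  denominators; 4096 = 4^6.\<close>

definition crossing_poly :: "real \<Rightarrow> real" where
  "crossing_poly a = (21 * a^3 + 299 * a^2 + 1391 * a + 2073) * (a^2 + 10 * a + 8)^6
     - 4096 * ((a + 1)^6 * (a + 3)^3 * (a + 5)^2 * (a + 7) * (a + 9) * (a + 11))"

lemma crossing_poly_eq:
  "crossing_poly a = 21 * a ^ 15 - (\<Sum>i<15. crossing_coeffs ! i * a ^ i)"
proof -
  have "(\<Sum>i<15. crossing_coeffs ! i * a ^ i) = 1372581888 * a ^ 0 + 10398908416 * a ^ 1 + 35323457536 * a ^ 2 + 71190233088 * a ^ 3 + 94921982976 * a ^ 4 + 88338003456 * a ^ 5 + 58924511424 * a ^ 6 + 28448573056 * a ^ 7 + 9921473872 * a ^ 8 + 2472600624 * a ^ 9 + 431639940 * a ^ 10 + 51006336 * a ^ 11 + 3834975 * a ^ 12 + 161153 * a ^ 13 + 2537 * a ^ 14"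
    by (simp add: crossing_coeffs_def eval_nat_numeral lessThan_Suc)
  then show ?thesis unfolding crossing_poly_def by algebra
qed

lemma crossing_poly_root_unique:
  assumes "0 < x" "crossing_poly x = 0" "0 < y" "crossing_poly y = 0"
  shows "x = y"
proof -
  have False if "0 < x" "crossing_poly x = 0" "x < y" "crossing_poly y = 0" for x y
  proof -
    have pos: "crossing_coeffs ! i > 0" if "i < 15" for i
    proof -
      have "\<forall>c\<in>set crossing_coeffs. c > 0" "length crossing_coeffs = 15" by (simp_all add: crossing_coeffs_def)
      with that show ?thesis by (metis nth_mem)
    qed
    have "(\<Sum>i<15. crossing_coeffs ! i * y ^ i) * x ^ 15 < (\<Sum>i<15. crossing_coeffs ! i * x ^ i) * y ^ 15"
      using that pos by (intro sum_powers_scaled_less) auto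
    moreover have "(\<Sum>i<15. crossing_coeffs ! i * x ^ i) = 21 * x ^ 15" "(\<Sum>i<15. crossing_coeffs ! i * y ^ i) = 21 * y ^ 15"
      using that by (simp_all add: crossing_poly_eq)
    ultimately show False by simp
  qed
  with assms show ?thesis by (metis linorder_less_linear)
qed

lemma c_upper_sq_1_pos: "\<alpha> > -1 \<Longrightarrow> c_upper_sq_1 \<alpha> > 0"
  and c_upper_sq_1_power_6: "\<alpha> > -1 \<Longrightarrow> c_upper_sq_1 \<alpha> ^ 6 =
    (21 * \<alpha>^3 + 299 * \<alpha>^2 + 1391 * \<alpha> + 2073) /
    ((\<alpha> + 1)^6 * (\<alpha> + 3)^3 * (\<alpha> + 5)^2 * (\<alpha> + 7) * (\<alpha> + 9) * (\<alpha> + 11))"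
proof -
  assume a: "\<alpha> > -1"
  \<comment> \<open>Expanding around -1 makes all coefficients positive, which settles the sign for
    negative \<alpha> as well.\<close>
  have "21 * \<alpha>^3 + 299 * \<alpha>^2 + 1391 * \<alpha> + 2073 = 21 * (\<alpha> + 1)^3 + 236 * (\<alpha> + 1)^2 + 856 * (\<alpha> + 1) + 960"
    by (simp add: power2_eq_square power3_eq_cube algebra_simps)
  also have "\<dots> > 0" using a by (intro add_nonneg_pos add_nonneg_nonneg) auto
  finally have N: "21 * \<alpha>^3 + 299 * \<alpha>^2 + 1391 * \<alpha> + 2073 > 0" .
  show "c_upper_sq_1 \<alpha> > 0"
    unfolding c_upper_sq_1_def using a N by (intro divide_pos_pos mult_pos_pos) auto
  have p: "(x powr (1/6)) ^ 6 = x" "(x powr (1/2)) ^ 6 = x ^ 3" "(x powr (1/3)) ^ 6 = x ^ 2" if "x > 0" for x :: real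
    using that by (simp_all add: powr_power powr_numeral)
  show "c_upper_sq_1 \<alpha> ^ 6 = (21 * \<alpha>^3 + 299 * \<alpha>^2 + 1391 * \<alpha> + 2073) /
    ((\<alpha> + 1)^6 * (\<alpha> + 3)^3 * (\<alpha> + 5)^2 * (\<alpha> + 7) * (\<alpha> + 9) * (\<alpha> + 11))"
    unfolding c_upper_sq_1_def power_divide power_mult_distrib
    using a N by (simp add: p mult.assoc)
qed

lemma c_upper_sq_crossing_iff:
  assumes "a > 2"
  shows "c_upper_sq_1 a = c_upper_sq_2 a \<longleftrightarrow> crossing_poly a = 0"
proof -
  define N D q where "N = 21 * a^3 + 299 * a^2 + 1391 * a + 2073"
    and "D = (a + 1)^6 * (a + 3)^3 * (a + 5)^2 * (a + 7) * (a + 9) * (a + 11)" and "q = a^2 + 10 * a + 8"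
  have D: "D > 0" unfolding D_def using assms by (intro mult_pos_pos zero_less_power) auto
  have q: "q > 0" unfolding q_def using assms by (intro add_nonneg_pos) auto
  have "c_upper_sq_2 a > 0" unfolding c_upper_sq_2_def using q by (simp add: q_def)
  then have "c_upper_sq_1 a = c_upper_sq_2 a \<longleftrightarrow> c_upper_sq_1 a ^ 6 = c_upper_sq_2 a ^ 6"
    using c_upper_sq_1_pos[of a] assms by (auto intro: power_eq_imp_eq_base[of _ 6])
  also have "\<dots> \<longleftrightarrow> N / D = 4 ^ 6 / q ^ 6"
    using assms by (simp add: c_upper_sq_1_power_6 c_upper_sq_2_def power_divide N_def D_def q_def)
  also have "\<dots> \<longleftrightarrow> N * q ^ 6 - 4096 * D = 0" using D q by (simp add: frac_eq_eq)
  also have "N * q ^ 6 - 4096 * D = crossing_poly a" by (simp add: crossing_poly_def N_def D_def q_def)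
  finally show ?thesis .
qed

lemma crossing_poly_root: "\<exists>a. 343/2 < a \<and> a < 345/2 \<and> crossing_poly a = 0"
proof -
  \<comment> \<open>The endpoints are 172 - 1/2 and 172 + 1/2, so the root is located with the
    claimed accuracy.\<close>
  have lo: "crossing_poly (343/2) < 0" by (simp add: crossing_poly_def power_divide)
  have hi: "crossing_poly (345/2) > 0" by (simp add: crossing_poly_def power_divide)
  have "\<exists>a\<ge>343/2. a \<le> 345/2 \<and> crossing_poly a = 0"
    using lo hi by (intro IVT') (auto simp: crossing_poly_def intro!: continuous_intros)
  then obtain a where a: "343/2 \<le> a" "a \<le> 345/2" "crossing_poly a = 0" by blast
  moreover have "a \<noteq> 343/2" "a \<noteq> 345/2" using a(3) lo hi by (metis less_irrefl)+
  ultimately show ?thesis by (intro exI[of _ a]) auto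
qed

text \<open>Uniqueness gives the description in \<open>alpha_star\<close> its meaning, and
  convergence does the same for the \<open>lim\<close> in
  \<open>asymptotic_markov_constant\<close>.\<close>

theorem corollary1p3:
  shows "(\<exists>!a::real. a > 2 \<and> c_upper_sq_1 a = c_upper_sq_2 a)
    \<and> \<bar>alpha_star - 172\<bar> < 1/2
    \<and> (\<forall>\<alpha>::real. \<alpha> > -1 \<longrightarrow>
          (\<lambda>n. markov_constant \<alpha> n / real n) \<longlonglongrightarrow> asymptotic_markov_constant \<alpha>
        \<and> 0 < c_lower \<alpha>
        \<and> c_lower \<alpha> < asymptotic_markov_constant \<alpha>
        \<and> asymptotic_markov_constant \<alpha> < c_upper \<alpha>)"
proof -
  obtain a where a: "343/2 < a" "a < 345/2" "crossing_poly a = 0" using crossing_poly_root by blast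
  have unique: "\<exists>!a::real. a > 2 \<and> c_upper_sq_1 a = c_upper_sq_2 a"
  proof (rule ex1I[of _ a])
    show "a > 2 \<and> c_upper_sq_1 a = c_upper_sq_2 a" using a c_upper_sq_crossing_iff[of a] by simp
    show "b = a" if "b > 2 \<and> c_upper_sq_1 b = c_upper_sq_2 b" for b
      using that a c_upper_sq_crossing_iff[of b] crossing_poly_root_unique[of b a] by simp
  qed
  then have star: "alpha_star = a"
    unfolding alpha_star_def using a c_upper_sq_crossing_iff[of a] by (intro the1_equality) auto
  have "(\<lambda>n. markov_constant \<alpha> n / real n) \<longlonglongrightarrow> asymptotic_markov_constant \<alpha>
        \<and> 0 < c_lower \<alpha> \<and> c_lower \<alpha> < asymptotic_markov_constant \<alpha>
        \<and> asymptotic_markov_constant \<alpha> < c_upper \<alpha>" if "\<alpha> > -1" for \<alpha>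
  proof -
    interpret laguerre \<alpha> by unfold_locales (rule that)
    have lim: "asymptotic_markov_constant \<alpha> = sqrt R"
      unfolding asymptotic_markov_constant_def using markov_constant_tendsto by (rule limI)
    have ratio: "c_lower \<alpha> = sqrt (s 6 / s 5)"
    proof -
      define p q r t v w where pqrtvw: "p = \<alpha> + 1" "q = \<alpha> + 3" "r = \<alpha> + 5" "t = \<alpha> + 7" "v = \<alpha> + 9" "w = \<alpha> + 11"
      have "p > 0" "q > 0" "r > 0" "t > 0" "v > 0" "w > 0" "7 * \<alpha> + 31 > 0"
        using that unfolding pqrtvw by linarith+
      then show ?thesis
        unfolding c_lower_def s_explicit pqrtvw[symmetric] by (simp add: divide_simps eval_nat_numeral)
    qed
    \<comment> \<open>The explicit value of s 6 is exactly the sixth power of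
      \<open>c_upper_sq_1\<close>.\<close>
    have "R < c_upper_sq_1 \<alpha>"
      using R_upper c_upper_sq_1_pos[OF that] unfolding s_explicit c_upper_sq_1_power_6[OF that, symmetric]
      by (rule power_less_imp_less_base[OF _ less_imp_le])
    \<comment> \<open>Beyond the crossing point \<alpha> exceeds 343/2, hence also the threshold
      171.\<close>
    moreover have "R < c_upper_sq_2 \<alpha>" if "\<not> \<alpha> \<le> alpha_star"
      unfolding c_upper_sq_2_def using that a(1) star by (intro R_less_large_alpha) simp
    ultimately have "sqrt R < c_upper \<alpha>" by (simp add: c_upper_def)
    moreover have "0 < s 6 / s 5" by (intro divide_pos_pos s_pos) auto
    ultimately show ?thesis
      using markov_constant_tendsto R_lower by (simp add: lim ratio)
  qed
  moreover have "\<bar>alpha_star - 172\<bar> < 1/2" using a star by linarith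
  ultimately show ?thesis using unique by metis
qed

end
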